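(* Let $W$ be a primitive $\omega$-Stone space. Then the maps $\mathscr{Y}\mapsto\mathrm{id}(\mathscr{Y})$ and $\mathscr{Z}\mapsto\mathscr{Z}^{o}$ are inverse bijections between the set of trim partitions $\mathscr{Y}$ and the set of rank partitions $\mathscr{Z}$ of $W$. In particular, the rank partitions of $W$ take precisely the form $\mathrm{id}(\mathscr{Y})$, where $\mathscr{Y}$ is a trim partition of $W$.
   Context: A PO system is a set $P$ with an antisymmetric transitive relation $<$ (possibly $p<p$ for some $p$); $p\leqslant q$ means $p<q$ or $p=q$; $p\lneqq q$ means $p\leqslant q$ and $p\neq q$; $P^{d}=\{p\in P: p\nless p\}$; $p_{\uparrow}=\{q\in P: q\geqslant p\}$, $p_{\downarrow}=\{q\in P:q\leqslant p\}$. Suprema are with respect to $\leqslant$, and strictly increasing is with respect to $\lneqq$. An ideal of $P$ is a non-empty lower subset $J$ such that any $x,y\in J$ have a common upper bound in $J$; principal ideals are those of the form $p_\downarrow$. The ideal completion $\mathrm{id}(P)$ is the set of ideals of $P$ ordered by inclusion, made into a PO system with $\mathrm{id}(P)^d=\{p_\downarrow\mid p\in P^d\}$ (so $J<K$ iff $J\subsetneqq K$, or $J=K\notin\mathrm{id}(P)^d$); $P$ is identified with the set of principal ideals. An element of $P$ is separated if it is not the supremum of a strictly increasing sequence in $P$. A Stone space $W$ is a locally compact Hausdorff space with a base of compact open sets (the Stone space of a Boolean ring, possibly without $1$); it is an $\omega$-Stone space if $R=\mathrm{Co}(W)$, the Boolean ring of compact open subsets, is countable. For $A\in R$ let $(A)=\{C\in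 R: C\subseteq A\}$; $A$ is pseudo-indecomposable (PI) if for all $B\in R$ with $B\subseteq A$, $(B)\cong(A)$ or $(A-B)\cong(A)$. $W$ is primitive if every element of $R$ is the disjoint union of finitely many PI elements. $\mathscr{X}=\{X_p\mid p\in P\}^{*}$ denotes a family of pairwise disjoint non-empty subsets $X_p$ of $W$ together with the remaining set $W-X$ (possibly empty), where $X=\bigcup_p X_p$; it is complete if $X=W$. With $S'$ the set of limit points of $S$, it is a $P$-partition if $X_p'\cap X=\bigcup_{q<p}X_q$ for all $p\in P$. Its label function is $\tau\colon X\to P$, $\tau(w)=p$ for $w\in X_p$. A compact open $A$ is $p$-trim, written $t(A)=p$, if $\{q:A\cap X_q\neq\emptyset\}=p_{\uparrow}$ and, if $p\in P^d$, also $|A\cap X_p|=1$; a set is trim if it is $p$-trim for some $p$; $\widehat{P}$ is the set of $p$ for which there is a $p$-trim set. For $w\in W$, $I_w=\{t(A)\mid A\text{ trim},\,w\in A\}$. A point $w$ is clean if $w\in X_p$ for some $p$ and $w$ has a $p$-trim neighbourhood. A $P$-partition is trim if: (T1) every element of $W$ has a neighbourhood base of trim sets; (T2) for each $p\in\widehat P$, every element of $W$ with a neighbourhood base of $p$-trim sets lies in $X_p$; (T3) all points in $X$ are clean. The clean interior of $\mathscr{X}$ is $\mathscr{X}^o=\{Z_q\mid q\in\widehat P\}^*$, where $Z_q$ is the set of clean points in $X_q$. For a trim $P$-partition $\mathscr{Y}$ of an $\omega$-Stone space $W$, the ideal completion is the complete partition $\mathrm{id}(\mathscr{Y})=\{Y(J)\mid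 J\in\mathrm{id}(P)\}$, where $Y(J)=\{w\in W\mid I_w=J\}$. A complete $P$-partition is a rank $P$-partition if: (RP1) if $q$ is separated, $x=\lim x_k$, $\tau(x)\geqslant q$ and $\{\tau(x_k)\mid k\geqslant1\}$ are either pairwise strictly incomparable or strictly increasing, then $\tau(x_k)\geqslant q$ for all but finitely many $k$; (RP2) if $\tau(x)$ is not separated, then $x=\lim x_k$ for some $x_k$ with $\tau(x_k)\lneqq\tau(x)$ for all $k$. A trim (rank) partition of $W$ is a trim (rank) $P$-partition for some PO system $P$; partitions that differ only by relabelling along an isomorphism of the index PO systems are identified. *)

theory Defs
  imports "HOL-Analysis.Analysis"
begin

section \<open>PO systems\<close>

record 'p po_system =
  pts :: "'p set"
  lt :: "('p \<times> 'p) set"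

definition is_po_system :: "'p po_system \<Rightarrow> bool" where
  "is_po_system P \<longleftrightarrow> lt P \<subseteq> pts P \<times> pts P \<and> antisym (lt P) \<and> trans (lt P)"

definition po_le :: "'p po_system \<Rightarrow> 'p \<Rightarrow> 'p \<Rightarrow> bool" where
  "po_le P p q \<longleftrightarrow> p \<in> pts P \<and> q \<in> pts P \<and> ((p, q) \<in> lt P \<or> p = q)"

definition po_less :: "'p po_system \<Rightarrow> 'p \<Rightarrow> 'p \<Rightarrow> bool" where
  "po_less P p q \<longleftrightarrow> po_le P p q \<and> p \<noteq> q"

definition pts_d :: "'p po_system \<Rightarrow> 'p set" where
  "pts_d P = {p \<in> pts P. (p, p) \<notin> lt P}"

definition up_set :: "'p po_system \<Rightarrow> 'p \<Rightarrow> 'p set" where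
  "up_set P p = {q \<in> pts P. po_le P p q}"

definition down_set :: "'p po_system \<Rightarrow> 'p \<Rightarrow> 'p set" where
  "down_set P p = {q \<in> pts P. po_le P q p}"

definition po_ideal :: "'p po_system \<Rightarrow> 'p set \<Rightarrow> bool" where
  "po_ideal P J \<longleftrightarrow> J \<noteq> {} \<and> J \<subseteq> pts P \<and>
     (\<forall>x\<in>J. \<forall>y. po_le P y x \<longrightarrow> y \<in> J) \<and>
     (\<forall>x\<in>J. \<forall>y\<in>J. \<exists>z\<in>J. po_le P x z \<and> po_le P y z)"

definition id_po :: "'p po_system \<Rightarrow> 'p set po_system" where
  "id_po P = \<lparr>pts = {J. po_ideal P J},
     lt = {(J, K). po_ideal P J \<and> po_ideal P K \<and>
             (J \<subset> K \<or> J = K \<and> J \<notin> down_set P ` pts_d P)}\<rparr>"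

definition is_po_sup :: "'p po_system \<Rightarrow> 'p set \<Rightarrow> 'p \<Rightarrow> bool" where
  "is_po_sup P S q \<longleftrightarrow> q \<in> pts P \<and> (\<forall>s\<in>S. po_le P s q) \<and>
     (\<forall>u\<in>pts P. (\<forall>s\<in>S. po_le P s u) \<longrightarrow> po_le P q u)"

definition po_separated :: "'p po_system \<Rightarrow> 'p \<Rightarrow> bool" where
  "po_separated P q \<longleftrightarrow> q \<in> pts P \<and>
     \<not> (\<exists>s :: nat \<Rightarrow> 'p. (\<forall>n. po_less P (s n) (s (Suc n))) \<and> is_po_sup P (range s) q)"


section \<open>Stone spaces\<close>

definition compact_opens :: "'w topology \<Rightarrow> 'w set set" where
  "compact_opens W = {A. openin W A \<and> compactin W A}"

definition stone_space :: "'w topology \<Rightarrow> bool" where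
  "stone_space W \<longleftrightarrow> locally_compact_space W \<and> Hausdorff_space W \<and>
     (\<forall>U w. openin W U \<and> w \<in> U \<longrightarrow> (\<exists>A\<in>compact_opens W. w \<in> A \<and> A \<subseteq> U))"

definition omega_stone_space :: "'w topology \<Rightarrow> bool" where
  "omega_stone_space W \<longleftrightarrow> stone_space W \<and> countable (compact_opens W)"

definition below :: "'w topology \<Rightarrow> 'w set \<Rightarrow> 'w set set" where
  "below W A = {C \<in> compact_opens W. C \<subseteq> A}"

text \<open>Isomorphism of Boolean rings of sets, with symmetric difference as addition and
  intersection as multiplication.\<close>

definition boolean_ring_iso :: "'w set set \<Rightarrow> 'w set set \<Rightarrow> bool" where
  "boolean_ring_iso R S \<longleftrightarrow> (\<exists>h. bij_betw h R S \<and>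
     (\<forall>C\<in>R. \<forall>D\<in>R. h (sym_diff C D) = sym_diff (h C) (h D) \<and> h (C \<inter> D) = h C \<inter> h D))"

definition pseudo_indecomposable :: "'w topology \<Rightarrow> 'w set \<Rightarrow> bool" where
  "pseudo_indecomposable W A \<longleftrightarrow> A \<in> compact_opens W \<and>
     (\<forall>B\<in>compact_opens W. B \<subseteq> A \<longrightarrow>
        boolean_ring_iso (below W B) (below W A) \<or>
        boolean_ring_iso (below W (A - B)) (below W A))"

definition primitive_space :: "'w topology \<Rightarrow> bool" where
  "primitive_space W \<longleftrightarrow> (\<forall>A\<in>compact_opens W.
     \<exists>F. finite F \<and> disjoint F \<and> (\<forall>B\<in>F. pseudo_indecomposable W B) \<and> \<Union>F = A)"


section \<open>Labelled partitions\<close>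

text \<open>The family \<open>{X\<^sub>p | p \<in> P}\<^sup>*\<close> is given by \<open>P\<close> and the map \<open>p \<mapsto> X\<^sub>p\<close>, whose values
  outside \<open>P\<close> are irrelevant; the remaining set \<open>W - X\<close> is determined by these data.\<close>

record ('p, 'w) labelled_family =
  index :: "'p po_system"
  block :: "'p \<Rightarrow> 'w set"

definition support :: "('p, 'w) labelled_family \<Rightarrow> 'w set" where
  "support \<X> = (\<Union>p\<in>pts (index \<X>). block \<X> p)"

definition P_partition :: "'w topology \<Rightarrow> ('p, 'w) labelled_family \<Rightarrow> bool" where
  "P_partition W \<X> \<longleftrightarrow> is_po_system (index \<X>) \<and>
     (\<forall>p\<in>pts (index \<X>). block \<X> p \<noteq> {} \<and> block \<X> p \<subseteq> topspace W) \<and>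
     disjoint_family_on (block \<X>) (pts (index \<X>)) \<and>
     (\<forall>p\<in>pts (index \<X>). (W derived_set_of block \<X> p) \<inter> support \<X> =
        (\<Union>q\<in>{q \<in> pts (index \<X>). (q, p) \<in> lt (index \<X>)}. block \<X> q))"

definition complete_family :: "'w topology \<Rightarrow> ('p, 'w) labelled_family \<Rightarrow> bool" where
  "complete_family W \<X> \<longleftrightarrow> support \<X> = topspace W"

text \<open>Only meaningful for points of the support.\<close>

definition label :: "('p, 'w) labelled_family \<Rightarrow> 'w \<Rightarrow> 'p" where
  "label \<X> w = (THE p. p \<in> pts (index \<X>) \<and> w \<in> block \<X> p)"

text \<open>\<open>p_trim W \<X> p A\<close> is the relation \<open>t(A) = p\<close>.\<close>

definition p_trim :: "'w topology \<Rightarrow> ('p, 'w) labelled_family \<Rightarrow> 'p \<Rightarrow> 'w set \<Rightarrow> bool" where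
  "p_trim W \<X> p A \<longleftrightarrow> p \<in> pts (index \<X>) \<and> A \<in> compact_opens W \<and>
     {q \<in> pts (index \<X>). A \<inter> block \<X> q \<noteq> {}} = up_set (index \<X>) p \<and>
     (p \<in> pts_d (index \<X>) \<longrightarrow> card (A \<inter> block \<X> p) = 1)"

definition trim_set :: "'w topology \<Rightarrow> ('p, 'w) labelled_family \<Rightarrow> 'w set \<Rightarrow> bool" where
  "trim_set W \<X> A \<longleftrightarrow> (\<exists>p. p_trim W \<X> p A)"

definition P_hat :: "'w topology \<Rightarrow> ('p, 'w) labelled_family \<Rightarrow> 'p set" where
  "P_hat W \<X> = {p \<in> pts (index \<X>). \<exists>A. p_trim W \<X> p A}"

definition trim_labels :: "'w topology \<Rightarrow> ('p, 'w) labelled_family \<Rightarrow> 'w \<Rightarrow> 'p set" where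
  "trim_labels W \<X> w = {p. \<exists>A. p_trim W \<X> p A \<and> w \<in> A}"

definition clean_point :: "'w topology \<Rightarrow> ('p, 'w) labelled_family \<Rightarrow> 'w \<Rightarrow> bool" where
  "clean_point W \<X> w \<longleftrightarrow>
     (\<exists>p\<in>pts (index \<X>). w \<in> block \<X> p \<and> (\<exists>A. p_trim W \<X> p A \<and> w \<in> A))"

definition trim_partition :: "'w topology \<Rightarrow> ('p, 'w) labelled_family \<Rightarrow> bool" where
  "trim_partition W \<X> \<longleftrightarrow> P_partition W \<X> \<and>
     (\<forall>w\<in>topspace W. \<forall>U. openin W U \<and> w \<in> U \<longrightarrow> (\<exists>A. trim_set W \<X> A \<and> w \<in> A \<and> A \<subseteq> U)) \<and>
     (\<forall>p\<in>P_hat W \<X>. \<forall>w\<in>topspace W.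
        (\<forall>U. openin W U \<and> w \<in> U \<longrightarrow> (\<exists>A. p_trim W \<X> p A \<and> w \<in> A \<and> A \<subseteq> U)) \<longrightarrow>
        w \<in> block \<X> p) \<and>
     (\<forall>w\<in>support \<X>. clean_point W \<X> w)"

definition clean_interior ::
    "'w topology \<Rightarrow> ('p, 'w) labelled_family \<Rightarrow> ('p, 'w) labelled_family" where
  "clean_interior W \<X> =
     \<lparr>index = \<lparr>pts = P_hat W \<X>, lt = lt (index \<X>) \<inter> P_hat W \<X> \<times> P_hat W \<X>\<rparr>,
      block = (\<lambda>q. {w \<in> block \<X> q. clean_point W \<X> w})\<rparr>"

definition ideal_completion ::
    "'w topology \<Rightarrow> ('p, 'w) labelled_family \<Rightarrow> ('p set, 'w) labelled_family" where
  "ideal_completion W \<Y> =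
     \<lparr>index = id_po (index \<Y>), block = (\<lambda>J. {w \<in> topspace W. trim_labels W \<Y> w = J})\<rparr>"

text \<open>Incomparability and strict increase of the labels are read for the family \<open>(\<tau>(x\<^sub>k))\<^sub>k\<close>: the labels
  \<open>\<tau>(x\<^sub>j)\<close> and \<open>\<tau>(x\<^sub>k)\<close> are incomparable for \<open>j \<noteq> k\<close>, or the sequence of labels
  is strictly increasing.\<close>

definition rank_partition :: "'w topology \<Rightarrow> ('p, 'w) labelled_family \<Rightarrow> bool" where
  "rank_partition W \<X> \<longleftrightarrow> P_partition W \<X> \<and> complete_family W \<X> \<and>
     (\<forall>q x (xs :: nat \<Rightarrow> 'w).
        po_separated (index \<X>) q \<and> range xs \<subseteq> topspace W \<and>
        limitin W xs x sequentially \<and> po_le (index \<X>) q (label \<X> x) \<and>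
        ((\<forall>j k. j \<noteq> k \<longrightarrow> \<not> po_le (index \<X>) (label \<X> (xs j)) (label \<X> (xs k))) \<or>
         (\<forall>k. po_less (index \<X>) (label \<X> (xs k)) (label \<X> (xs (Suc k))))) \<longrightarrow>
        (\<forall>\<^sub>F k in sequentially. po_le (index \<X>) q (label \<X> (xs k)))) \<and>
     (\<forall>x\<in>topspace W. \<not> po_separated (index \<X>) (label \<X> x) \<longrightarrow>
        (\<exists>xs :: nat \<Rightarrow> 'w. range xs \<subseteq> topspace W \<and> limitin W xs x sequentially \<and>
           (\<forall>k. po_less (index \<X>) (label \<X> (xs k)) (label \<X> x))))"


section \<open>Partitions up to relabelling\<close>

definition relabels_via ::
    "('p \<Rightarrow> 'q) \<Rightarrow> ('p, 'w) labelled_family \<Rightarrow> ('q, 'w) labelled_family \<Rightarrow> bool" where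
  "relabels_via f \<X> \<Z> \<longleftrightarrow>
     is_po_system (index \<X>) \<and> is_po_system (index \<Z>) \<and>
     bij_betw f (pts (index \<X>)) (pts (index \<Z>)) \<and>
     (\<forall>p\<in>pts (index \<X>). \<forall>q\<in>pts (index \<X>).
        (p, q) \<in> lt (index \<X>) \<longleftrightarrow> (f p, f q) \<in> lt (index \<Z>)) \<and>
     (\<forall>p\<in>pts (index \<X>). block \<Z> (f p) = block \<X> p)"

definition same_up_to_relabelling ::
    "('p, 'w) labelled_family \<Rightarrow> ('q, 'w) labelled_family \<Rightarrow> bool" (infix \<open>\<simeq>\<^sub>r\<close> 50) where
  "\<X> \<simeq>\<^sub>r \<Z> \<longleftrightarrow> (\<exists>f. relabels_via f \<X> \<Z>)"

text \<open>The blocks of a partition are non-empty and disjoint, so every relabelling class has exactly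
  one member in which each block is its own label.  This member represents the class, whatever
  the type of the original labels was.\<close>

definition canonical :: "('p, 'w) labelled_family \<Rightarrow> ('w set, 'w) labelled_family" where
  "canonical \<X> =
     \<lparr>index = \<lparr>pts = block \<X> ` pts (index \<X>),
               lt = (\<lambda>(p, q). (block \<X> p, block \<X> q)) ` lt (index \<X>)\<rparr>,
      block = (\<lambda>A. A)\<rparr>"

lemma relabels_via_sym:
  assumes "relabels_via f \<X> \<Z>"
  shows "relabels_via (inv_into (pts (index \<X>)) f) \<Z> \<X>"
proof -
  let ?g = "inv_into (pts (index \<X>)) f"
  have b: "bij_betw f (pts (index \<X>)) (pts (index \<Z>))"
    using assms by (simp add: relabels_via_def)
  have g: "?g r \<in> pts (index \<X>)" "f (?g r) = r" if "r \<in> pts (index \<Z>)" for r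
    using that bij_betw_inv_into_right[OF b that] inv_into_into[of r f] bij_betw_imp_surj_on[OF b]
    by auto
  show ?thesis
    using assms g bij_betw_inv_into[OF b] unfolding relabels_via_def by metis
qed

lemma same_up_to_relabelling_sym: "\<X> \<simeq>\<^sub>r \<Z> \<Longrightarrow> \<Z> \<simeq>\<^sub>r \<X>"
  using relabels_via_sym unfolding same_up_to_relabelling_def by blast

lemma P_partition_inj_on_block: "P_partition W \<X> \<Longrightarrow> inj_on (block \<X>) (pts (index \<X>))"
  unfolding P_partition_def disjoint_family_on_def inj_on_def by (metis inf.idem)

lemma relabels_via_canonical:
  assumes "P_partition W \<X>"
  shows "relabels_via (block \<X>) \<X> (canonical \<X>)"
proof -
  have i: "inj_on (block \<X>) (pts (index \<X>))"
    using assms by (rule P_partition_inj_on_block)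
  have P: "lt (index \<X>) \<subseteq> pts (index \<X>) \<times> pts (index \<X>)" "antisym (lt (index \<X>))"
    "trans (lt (index \<X>))"
    using assms by (auto simp: P_partition_def is_po_system_def)
  have e: "(block \<X> p, block \<X> q) \<in> lt (index (canonical \<X>)) \<longleftrightarrow> (p, q) \<in> lt (index \<X>)"
    if pq: "p \<in> pts (index \<X>)" "q \<in> pts (index \<X>)" for p q
  proof
    assume "(block \<X> p, block \<X> q) \<in> lt (index (canonical \<X>))"
    then obtain p' q' where "(p', q') \<in> lt (index \<X>)" "block \<X> p = block \<X> p'"
      "block \<X> q = block \<X> q'"
      by (auto simp: canonical_def)
    moreover from this have "p = p'" "q = q'"
      using P(1) pq inj_onD[OF i] by blast+
    ultimately show "(p, q) \<in> lt (index \<X>)" by simp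
  next
    assume "(p, q) \<in> lt (index \<X>)"
    then show "(block \<X> p, block \<X> q) \<in> lt (index (canonical \<X>))"
      by (force simp: canonical_def)
  qed
  have s: "lt (index (canonical \<X>)) \<subseteq> pts (index (canonical \<X>)) \<times> pts (index (canonical \<X>))"
    using P(1) by (auto simp: canonical_def)
  have pt: "pts (index (canonical \<X>)) = block \<X> ` pts (index \<X>)"
    by (simp add: canonical_def)
  have l: "lt (index (canonical \<X>)) = {(block \<X> p, block \<X> q) |p q. (p, q) \<in> lt (index \<X>)}"
    by (auto simp: canonical_def)
  have m: "p \<in> pts (index \<X>)" "q \<in> pts (index \<X>)" if "(p, q) \<in> lt (index \<X>)" for p q
    using P(1) that by auto
  have "antisym (lt (index (canonical \<X>)))"
  proof (rule antisymI)
    fix A B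
    assume AB: "(A, B) \<in> lt (index (canonical \<X>))" "(B, A) \<in> lt (index (canonical \<X>))"
    from AB(1) obtain p q where pq: "(p, q) \<in> lt (index \<X>)" "A = block \<X> p" "B = block \<X> q"
      unfolding l by auto
    moreover have "(q, p) \<in> lt (index \<X>)"
      using AB(2) e[OF m(2)[OF pq(1)] m(1)[OF pq(1)]] pq(2,3) by simp
    ultimately show "A = B" using antisymD[OF P(2)] by blast
  qed
  moreover have "trans (lt (index (canonical \<X>)))"
  proof (rule transI)
    fix A B C
    assume AB: "(A, B) \<in> lt (index (canonical \<X>))" "(B, C) \<in> lt (index (canonical \<X>))"
    from AB(1) obtain p q where pq: "(p, q) \<in> lt (index \<X>)" "A = block \<X> p" "B = block \<X> q"
      unfolding l by auto
    from AB(2) obtain q' r where qr: "(q', r) \<in> lt (index \<X>)" "B = block \<X> q'" "C = block \<X> r"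
      unfolding l by auto
    have "q' = q"
      using inj_onD[OF i, of q' q] pq qr m by simp
    then have "(p, r) \<in> lt (index \<X>)"
      using pq(1) qr(1) transD[OF P(3)] by simp
    then show "(A, C) \<in> lt (index (canonical \<X>))"
      using e[OF m(1)[OF pq(1)] m(2)[OF qr(1)]] pq(2) qr(3) by simp
  qed
  ultimately have po: "is_po_system (index (canonical \<X>))"
    using s by (simp add: is_po_system_def)
  have "bij_betw (block \<X>) (pts (index \<X>)) (pts (index (canonical \<X>)))"
    using i by (simp add: pt bij_betw_def)
  moreover have "is_po_system (index \<X>)"
    using assms by (simp add: P_partition_def)
  ultimately show ?thesis
    using po e by (simp add: relabels_via_def canonical_def)
qed

lemma canonical_cong:
  assumes "\<X> \<simeq>\<^sub>r \<Z>"
  shows "canonical \<X> = canonical \<Z>"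
proof -
  obtain f where f: "relabels_via f \<X> \<Z>"
    using assms by (auto simp: same_up_to_relabelling_def)
  have P: "lt (index \<X>) \<subseteq> pts (index \<X>) \<times> pts (index \<X>)"
      "lt (index \<Z>) \<subseteq> pts (index \<Z>) \<times> pts (index \<Z>)"
    and im: "pts (index \<Z>) = f ` pts (index \<X>)"
    and o: "\<And>p q. p \<in> pts (index \<X>) \<Longrightarrow> q \<in> pts (index \<X>) \<Longrightarrow>
              (p, q) \<in> lt (index \<X>) \<longleftrightarrow> (f p, f q) \<in> lt (index \<Z>)"
    and bl: "\<And>p. p \<in> pts (index \<X>) \<Longrightarrow> block \<Z> (f p) = block \<X> p"
    using f unfolding relabels_via_def is_po_system_def bij_betw_def by auto
  have "lt (index \<Z>) = (\<lambda>(p, q). (f p, f q)) ` lt (index \<X>)"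
  proof (intro set_eqI iffI)
    fix z assume z: "z \<in> lt (index \<Z>)"
    then obtain p q where pq: "z = (f p, f q)" "p \<in> pts (index \<X>)" "q \<in> pts (index \<X>)"
      using P(2) im by blast
    then have "(p, q) \<in> lt (index \<X>)" using z o by blast
    then show "z \<in> (\<lambda>(p, q). (f p, f q)) ` lt (index \<X>)" using pq by force
  next
    fix z assume "z \<in> (\<lambda>(p, q). (f p, f q)) ` lt (index \<X>)"
    then obtain p q where "z = (f p, f q)" "(p, q) \<in> lt (index \<X>)" by auto
    then show "z \<in> lt (index \<Z>)" using P(1) o by blast
  qed
  then have "(\<lambda>(p, q). (block \<Z> p, block \<Z> q)) ` lt (index \<Z>) =
      (\<lambda>(p, q). (block \<Z> (f p), block \<Z> (f q))) ` lt (index \<X>)"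
    by (simp add: image_image case_prod_unfold)
  also have "\<dots> = (\<lambda>(p, q). (block \<X> p, block \<X> q)) ` lt (index \<X>)"
    using P(1) bl by (intro image_cong) auto
  finally show ?thesis
    using im bl by (simp add: canonical_def image_image)
qed

lemma relabels_via_trans:
  assumes "relabels_via f \<X> \<Y>" "relabels_via g \<Y> \<Z>"
  shows "relabels_via (g \<circ> f) \<X> \<Z>"
proof -
  have "f p \<in> pts (index \<Y>)" if "p \<in> pts (index \<X>)" for p
    using assms(1) that by (auto simp: relabels_via_def bij_betw_def)
  moreover have "bij_betw (g \<circ> f) (pts (index \<X>)) (pts (index \<Z>))"
    using assms bij_betw_trans unfolding relabels_via_def by blast
  ultimately show ?thesis
    using assms by (simp add: relabels_via_def)
qed

lemma same_up_to_relabelling_iff_canonical: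
  assumes "P_partition W \<X>" "P_partition W \<Z>"
  shows "\<X> \<simeq>\<^sub>r \<Z> \<longleftrightarrow> canonical \<X> = canonical \<Z>"
proof
  assume "canonical \<X> = canonical \<Z>"
  then have "relabels_via (block \<X>) \<X> (canonical \<Z>)"
    using relabels_via_canonical[OF assms(1)] by simp
  then show "\<X> \<simeq>\<^sub>r \<Z>"
    using relabels_via_trans relabels_via_sym[OF relabels_via_canonical[OF assms(2)]]
    unfolding same_up_to_relabelling_def by blast
qed (rule canonical_cong)

lemma canonical_canonical:
  assumes "P_partition W \<X>"
  shows "canonical (canonical \<X>) = canonical \<X>"
proof -
  have "\<X> \<simeq>\<^sub>r canonical \<X>"
    unfolding same_up_to_relabelling_def by (rule exI) (rule relabels_via_canonical[OF assms])
  then show ?thesis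
    by (rule canonical_cong[symmetric])
qed

text \<open>All notions are invariant under relabelling, so no generality is lost by working with
  canonical representatives.\<close>

context
  fixes f :: "'p \<Rightarrow> 'q" and \<X> :: "('p, 'w) labelled_family"
    and \<Z> :: "('q, 'w) labelled_family" and W :: "'w topology"
  assumes f: "relabels_via f \<X> \<Z>"
begin

lemma relabels_via_facts:
  shows relabel_po: "is_po_system (index \<X>)" "is_po_system (index \<Z>)"
    and relabel_image: "pts (index \<Z>) = f ` pts (index \<X>)"
    and relabel_inj: "p \<in> pts (index \<X>) \<Longrightarrow> q \<in> pts (index \<X>) \<Longrightarrow> f p = f q \<longleftrightarrow> p = q"
    and relabel_lt: "p \<in> pts (index \<X>) \<Longrightarrow> q \<in> pts (index \<X>) \<Longrightarrow>
           (f p, f q) \<in> lt (index \<Z>) \<longleftrightarrow> (p, q) \<in> lt (index \<X>)"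
    and relabel_block: "p \<in> pts (index \<X>) \<Longrightarrow> block \<Z> (f p) = block \<X> p"
  using f by (auto simp: relabels_via_def bij_betw_def inj_on_def)

lemma relabel_mem: "p \<in> pts (index \<X>) \<Longrightarrow> f p \<in> pts (index \<Z>)"
  by (simp add: relabel_image)

lemma relabel_le:
  "p \<in> pts (index \<X>) \<Longrightarrow> q \<in> pts (index \<X>) \<Longrightarrow> po_le (index \<Z>) (f p) (f q) \<longleftrightarrow> po_le (index \<X>) p q"
  by (simp add: po_le_def relabel_mem relabel_lt relabel_inj)

lemma relabel_less:
  "p \<in> pts (index \<X>) \<Longrightarrow> q \<in> pts (index \<X>) \<Longrightarrow> po_less (index \<Z>) (f p) (f q) \<longleftrightarrow> po_less (index \<X>) p q"
  by (simp add: po_less_def relabel_le relabel_inj)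

lemma relabel_support: "support \<Z> = support \<X>"
  by (simp add: support_def relabel_image relabel_block)

lemma relabel_P_partition:
  assumes X: "P_partition W \<X>"
  shows "P_partition W \<Z>"
proof -
  have "(\<Union>q\<in>{q \<in> pts (index \<Z>). (q, f p) \<in> lt (index \<Z>)}. block \<Z> q) =
        (\<Union>q\<in>{q \<in> pts (index \<X>). (q, p) \<in> lt (index \<X>)}. block \<X> q)"
    if p: "p \<in> pts (index \<X>)" for p
  proof -
    have "{q \<in> pts (index \<Z>). (q, f p) \<in> lt (index \<Z>)} =
          f ` {q \<in> pts (index \<X>). (q, p) \<in> lt (index \<X>)}"
      using p by (auto simp: relabel_image relabel_lt)
    then show ?thesis by (simp add: relabel_block)
  qed
  then show ?thesis
    using X unfolding P_partition_def disjoint_family_on_def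
    by (simp add: relabel_po relabel_image relabel_block relabel_support relabel_inj)
qed

lemma relabel_p_trim:
  assumes p: "p \<in> pts (index \<X>)"
  shows "p_trim W \<Z> (f p) A \<longleftrightarrow> p_trim W \<X> p A"
proof -
  have "{q \<in> pts (index \<Z>). A \<inter> block \<Z> q \<noteq> {}} = f ` {q \<in> pts (index \<X>). A \<inter> block \<X> q \<noteq> {}}"
    by (auto simp: relabel_image relabel_block intro!: imageI)
  moreover have "up_set (index \<Z>) (f p) = f ` up_set (index \<X>) p"
    using p by (auto simp: up_set_def relabel_image relabel_le)
  moreover have "inj_on f (pts (index \<X>))"
    by (auto simp: inj_on_def relabel_inj)
  then have "f ` S = f ` T \<longleftrightarrow> S = T" if "S \<subseteq> pts (index \<X>)" "T \<subseteq> pts (index \<X>)" for S T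
    using that by (rule inj_on_image_eq_iff)
  then have "f ` {q \<in> pts (index \<X>). A \<inter> block \<X> q \<noteq> {}} = f ` up_set (index \<X>) p \<longleftrightarrow>
      {q \<in> pts (index \<X>). A \<inter> block \<X> q \<noteq> {}} = up_set (index \<X>) p"
    by (simp add: up_set_def)
  moreover have "f p \<in> pts_d (index \<Z>) \<longleftrightarrow> p \<in> pts_d (index \<X>)"
    using p by (simp add: pts_d_def relabel_mem relabel_lt)
  ultimately show ?thesis
    using p by (simp add: p_trim_def relabel_mem relabel_block)
qed

lemma relabel_p_trimE:
  assumes "p_trim W \<Z> r A"
  obtains p where "p \<in> pts (index \<X>)" "r = f p" "p_trim W \<X> p A"
proof -
  from assms have "r \<in> f ` pts (index \<X>)"
    by (simp add: p_trim_def relabel_image)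
  then show thesis
    using assms that relabel_p_trim by blast
qed

lemma relabel_trim_set: "trim_set W \<Z> A \<longleftrightarrow> trim_set W \<X> A"
proof
  assume "trim_set W \<Z> A"
  then show "trim_set W \<X> A"
    unfolding trim_set_def using relabel_p_trimE by blast
next
  assume "trim_set W \<X> A"
  then obtain p where "p_trim W \<X> p A" "p \<in> pts (index \<X>)"
    by (auto simp: trim_set_def p_trim_def)
  then show "trim_set W \<Z> A"
    unfolding trim_set_def using relabel_p_trim by blast
qed

lemma relabel_P_hat: "P_hat W \<Z> = f ` P_hat W \<X>"
  by (auto simp: P_hat_def relabel_image relabel_p_trim intro!: imageI)

lemma relabel_clean_point: "clean_point W \<Z> w \<longleftrightarrow> clean_point W \<X> w"
  by (simp add: clean_point_def relabel_image relabel_block relabel_p_trim)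

lemma relabel_trim_partition:
  assumes "trim_partition W \<X>"
  shows "trim_partition W \<Z>"
proof -
  have "p \<in> pts (index \<X>)" if "p \<in> P_hat W \<X>" for p
    using that by (simp add: P_hat_def)
  then show ?thesis
    using assms relabel_P_partition unfolding trim_partition_def
    by (simp add: relabel_trim_set relabel_P_hat relabel_p_trim relabel_block relabel_support
        relabel_clean_point)
qed

lemma relabel_is_po_sup:
  assumes q: "q \<in> pts (index \<X>)" and S: "S \<subseteq> pts (index \<X>)"
  shows "is_po_sup (index \<Z>) (f ` S) (f q) \<longleftrightarrow> is_po_sup (index \<X>) S q"
proof -
  have "po_le (index \<Z>) (f s) (f u) \<longleftrightarrow> po_le (index \<X>) s u" if "s \<in> S" "u \<in> pts (index \<X>)" for s u
    using that S relabel_le by blast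
  then show ?thesis
    using q by (simp add: is_po_sup_def relabel_image relabel_le)
qed

lemma relabel_separated_imp:
  assumes q: "q \<in> pts (index \<X>)" and sep: "po_separated (index \<Z>) (f q)"
  shows "po_separated (index \<X>) q"
proof -
  have False if s: "\<forall>n. po_less (index \<X>) (s n) (s (Suc n))" "is_po_sup (index \<X>) (range s) q"
    for s :: "nat \<Rightarrow> 'p"
  proof -
    have sp: "s n \<in> pts (index \<X>)" for n
      using s(1) by (auto simp: po_less_def po_le_def)
    then have "\<forall>n. po_less (index \<Z>) (f (s n)) (f (s (Suc n)))"
      using s(1) by (simp add: relabel_less)
    moreover have "is_po_sup (index \<Z>) (range (\<lambda>n. f (s n))) (f q)"
      using relabel_is_po_sup[OF q, of "range s"] s(2) sp by (simp add: image_image image_subset_iff)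
    ultimately have "\<exists>t :: nat \<Rightarrow> 'q. (\<forall>n. po_less (index \<Z>) (t n) (t (Suc n))) \<and>
        is_po_sup (index \<Z>) (range t) (f q)"
      by (intro exI[of _ "\<lambda>n. f (s n)"] conjI)
    then show False
      using sep unfolding po_separated_def by simp
  qed
  then show ?thesis
    using q by (auto simp: po_separated_def)
qed

lemma relabel_label:
  assumes "P_partition W \<X>" "x \<in> support \<X>"
  shows "label \<X> x \<in> pts (index \<X>)" "label \<Z> x = f (label \<X> x)"
proof -
  obtain p where p: "p \<in> pts (index \<X>)" "x \<in> block \<X> p"
    using assms(2) by (auto simp: support_def)
  have u: "q = p" if "q \<in> pts (index \<X>)" "x \<in> block \<X> q" for q
    using that p assms(1) unfolding P_partition_def disjoint_family_on_def by blast
  have "label \<X> x = p"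
    unfolding label_def using p u by blast
  moreover have "label \<Z> x = f p"
    unfolding label_def
  proof (rule the_equality)
    show "f p \<in> pts (index \<Z>) \<and> x \<in> block \<Z> (f p)"
      using p by (simp add: relabel_mem relabel_block)
    fix r assume r: "r \<in> pts (index \<Z>) \<and> x \<in> block \<Z> r"
    then obtain q where "q \<in> pts (index \<X>)" "r = f q"
      using relabel_image by blast
    with r show "r = f p"
      using u[of q] by (simp add: relabel_block)
  qed
  ultimately show "label \<X> x \<in> pts (index \<X>)" "label \<Z> x = f (label \<X> x)"
    using p by auto
qed

end

lemma relabel_separated:
  assumes f: "relabels_via f \<X> \<Z>" and q: "q \<in> pts (index \<X>)"
  shows "po_separated (index \<Z>) (f q) \<longleftrightarrow> po_separated (index \<X>) q"
proof
  assume "po_separated (index \<X>) q"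
  moreover have "inv_into (pts (index \<X>)) f (f q) = q"
    using f q by (meson bij_betw_inv_into_left relabels_via_def)
  ultimately show "po_separated (index \<Z>) (f q)"
    using relabel_separated_imp[OF relabels_via_sym[OF f]] relabel_mem[OF f q] by simp
qed (rule relabel_separated_imp[OF f q])

lemma relabel_rank_partition:
  assumes f: "relabels_via f \<X> \<Z>" and X: "rank_partition W \<X>"
  shows "rank_partition W \<Z>"
proof -
  have PX: "P_partition W \<X>" and c: "support \<X> = topspace W"
    using X by (auto simp: rank_partition_def complete_family_def)
  note lab = relabel_label[OF f PX, unfolded c]
  show ?thesis
    unfolding rank_partition_def
  proof (intro conjI allI ballI impI)
    show "P_partition W \<Z>" by (rule relabel_P_partition[OF f PX])
    show "complete_family W \<Z>" by (simp add: complete_family_def relabel_support[OF f] c)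
  next
    fix r x and xs :: "nat \<Rightarrow> 'c"
    assume H: "po_separated (index \<Z>) r \<and> range xs \<subseteq> topspace W \<and>
        limitin W xs x sequentially \<and> po_le (index \<Z>) r (label \<Z> x) \<and>
        ((\<forall>j k. j \<noteq> k \<longrightarrow> \<not> po_le (index \<Z>) (label \<Z> (xs j)) (label \<Z> (xs k))) \<or>
         (\<forall>k. po_less (index \<Z>) (label \<Z> (xs k)) (label \<Z> (xs (Suc k)))))"
    then have x: "x \<in> topspace W" "\<And>k. xs k \<in> topspace W"
      by (auto dest: limitin_topspace)
    obtain q where q: "q \<in> pts (index \<X>)" "r = f q"
      using H relabel_image[OF f] by (auto simp: po_separated_def)
    have H': "po_separated (index \<X>) q \<and> range xs \<subseteq> topspace W \<and>
        limitin W xs x sequentially \<and> po_le (index \<X>) q (label \<X> x) \<and>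
        ((\<forall>j k. j \<noteq> k \<longrightarrow> \<not> po_le (index \<X>) (label \<X> (xs j)) (label \<X> (xs k))) \<or>
         (\<forall>k. po_less (index \<X>) (label \<X> (xs k)) (label \<X> (xs (Suc k)))))"
      using H x q by (simp add: lab relabel_le[OF f] relabel_less[OF f] relabel_separated[OF f])
    have "\<forall>\<^sub>F k in sequentially. po_le (index \<X>) q (label \<X> (xs k))"
      using X H' unfolding rank_partition_def by blast
    then show "\<forall>\<^sub>F k in sequentially. po_le (index \<Z>) r (label \<Z> (xs k))"
      using x q by (simp add: lab relabel_le[OF f])
  next
    fix x assume x: "x \<in> topspace W" "\<not> po_separated (index \<Z>) (label \<Z> x)"
    then have "\<not> po_separated (index \<X>) (label \<X> x)"
      by (simp add: lab relabel_separated[OF f])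
    then obtain xs :: "nat \<Rightarrow> 'c" where xs: "range xs \<subseteq> topspace W" "limitin W xs x sequentially"
      "\<forall>k. po_less (index \<X>) (label \<X> (xs k)) (label \<X> x)"
      using X x by (auto simp: rank_partition_def)
    then have "\<forall>k. po_less (index \<Z>) (label \<Z> (xs k)) (label \<Z> x)"
      using x by (simp add: lab relabel_less[OF f] image_subset_iff)
    then show "\<exists>xs :: nat \<Rightarrow> 'c. range xs \<subseteq> topspace W \<and> limitin W xs x sequentially \<and>
           (\<forall>k. po_less (index \<Z>) (label \<Z> (xs k)) (label \<Z> x))"
      using xs by blast
  qed
qed

lemma relabel_clean_interior:
  assumes f: "relabels_via f \<X> \<Z>"
  shows "relabels_via f (clean_interior W \<X>) (clean_interior W \<Z>)"
proof -
  have h: "p \<in> pts (index \<X>)" if "p \<in> P_hat W \<X>" for p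
    using that by (simp add: P_hat_def)
  have "inj_on f (P_hat W \<X>)"
    using h by (auto simp: inj_on_def relabel_inj[OF f])
  moreover have "is_po_system (index (clean_interior W \<X>))"
    using relabel_po(1)[OF f] by (auto simp: is_po_system_def clean_interior_def antisym_def trans_def)
  moreover have "is_po_system (index (clean_interior W \<Z>))"
    using relabel_po(2)[OF f] by (auto simp: is_po_system_def clean_interior_def antisym_def trans_def)
  ultimately show ?thesis
    using h
    by (auto simp: relabels_via_def bij_betw_def clean_interior_def relabel_P_hat[OF f]
        relabel_lt[OF f] relabel_block[OF f] relabel_clean_point[OF f])
qed

lemma is_po_system_id_po: "is_po_system (id_po P)"
  by (auto simp: is_po_system_def id_po_def antisym_def trans_def)

lemma relabel_ideal_imp:
  assumes f: "relabels_via f \<X> \<Z>" and J: "po_ideal (index \<X>) J"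
  shows "po_ideal (index \<Z>) (f ` J)"
proof -
  have s: "J \<subseteq> pts (index \<X>)" and n: "J \<noteq> {}"
    using J by (auto simp: po_ideal_def)
  have "y \<in> f ` J" if xy: "x \<in> J" "po_le (index \<Z>) y (f x)" for x y
  proof -
    obtain p where p: "p \<in> pts (index \<X>)" "y = f p"
      using xy(2) relabel_image[OF f] by (auto simp: po_le_def)
    then have "po_le (index \<X>) p x"
      using xy s relabel_le[OF f] by blast
    then show ?thesis using J xy(1) p by (auto simp: po_ideal_def)
  qed
  moreover have "\<exists>z\<in>J. po_le (index \<Z>) (f x) (f z) \<and> po_le (index \<Z>) (f y) (f z)"
    if "x \<in> J" "y \<in> J" for x y
    using that J s relabel_le[OF f] unfolding po_ideal_def by (meson subsetD)
  ultimately show ?thesis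
    using s n relabel_image[OF f] unfolding po_ideal_def by auto
qed

lemma relabel_ideals:
  assumes f: "relabels_via f \<X> \<Z>"
  shows "{K. po_ideal (index \<Z>) K} = (`) f ` {J. po_ideal (index \<X>) J}"
proof (intro set_eqI iffI)
  fix K assume "K \<in> {K. po_ideal (index \<Z>) K}"
  then have K: "po_ideal (index \<Z>) K" by simp
  let ?g = "inv_into (pts (index \<X>)) f"
  have "K \<subseteq> f ` pts (index \<X>)"
    using K relabel_image[OF f] by (auto simp: po_ideal_def)
  then have "K = f ` (?g ` K)"
    by (simp add: image_inv_into_cancel)
  then show "K \<in> (`) f ` {J. po_ideal (index \<X>) J}"
    using relabel_ideal_imp[OF relabels_via_sym[OF f] K] by blast
qed (use relabel_ideal_imp[OF f] in auto)

lemma relabel_ideal_completion: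
  assumes f: "relabels_via f \<X> \<Z>"
  shows "relabels_via ((`) f) (ideal_completion W \<X>) (ideal_completion W \<Z>)"
proof -
  let ?P = "index \<X>" and ?Q = "index \<Z>"
  have s: "J \<subseteq> pts ?P" if "po_ideal ?P J" for J
    using that by (simp add: po_ideal_def)
  have inj: "inj_on f (pts ?P)"
    by (auto simp: inj_on_def relabel_inj[OF f])
  have eq: "f ` J = f ` K \<longleftrightarrow> J = K" if "J \<subseteq> pts ?P" "K \<subseteq> pts ?P" for J K
    using inj that by (rule inj_on_image_eq_iff)
  have sub: "f ` J \<subset> f ` K \<longleftrightarrow> J \<subset> K" if "J \<subseteq> pts ?P" "K \<subseteq> pts ?P" for J K
    using that eq inj_on_image_subset_iff[OF inj] by (simp add: psubset_eq)
  have d: "pts_d ?Q = f ` pts_d ?P"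
    by (auto simp: pts_d_def relabel_image[OF f] relabel_lt[OF f])
  have dn: "down_set ?Q (f p) = f ` down_set ?P p" if "p \<in> pts ?P" for p
    using that by (auto simp: down_set_def relabel_image[OF f] relabel_le[OF f])
  have prin: "f ` J \<in> down_set ?Q ` pts_d ?Q \<longleftrightarrow> J \<in> down_set ?P ` pts_d ?P" if "J \<subseteq> pts ?P" for J
  proof -
    have "f ` J = down_set ?Q (f p) \<longleftrightarrow> J = down_set ?P p" if "p \<in> pts_d ?P" for p
      using that eq[OF \<open>J \<subseteq> pts ?P\<close>, of "down_set ?P p"] dn by (auto simp: pts_d_def down_set_def)
    then show ?thesis by (auto simp: d)
  qed
  have tl: "trim_labels W \<Z> w = f ` trim_labels W \<X> w" for w
  proof (intro set_eqI iffI)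
    fix r assume "r \<in> trim_labels W \<Z> w"
    then show "r \<in> f ` trim_labels W \<X> w"
      unfolding trim_labels_def using relabel_p_trimE[OF f] by blast
  next
    fix r assume "r \<in> f ` trim_labels W \<X> w"
    then obtain p A where "r = f p" "p_trim W \<X> p A" "w \<in> A" "p \<in> pts ?P"
      by (auto simp: trim_labels_def p_trim_def)
    then show "r \<in> trim_labels W \<Z> w"
      unfolding trim_labels_def using relabel_p_trim[OF f] by blast
  qed
  have ts: "trim_labels W \<X> w \<subseteq> pts ?P" for w
    by (auto simp: trim_labels_def p_trim_def)
  have "inj_on ((`) f) {J. po_ideal ?P J}"
    using s eq by (auto simp: inj_on_def)
  moreover have "is_po_system (index (ideal_completion W \<X>))"
    "is_po_system (index (ideal_completion W \<Z>))"
    by (simp_all add: ideal_completion_def is_po_system_id_po)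
  ultimately show ?thesis
    using relabel_ideal_imp[OF f] s
    by (auto simp: relabels_via_def ideal_completion_def id_po_def bij_betw_def
        relabel_ideals[OF f] tl eq ts sub prin)
qed

definition trim_partitions :: "'w topology \<Rightarrow> ('w set, 'w) labelled_family set" where
  "trim_partitions W = {\<Y>. trim_partition W \<Y> \<and> canonical \<Y> = \<Y>}"

definition rank_partitions :: "'w topology \<Rightarrow> ('w set, 'w) labelled_family set" where
  "rank_partitions W = {\<Z>. rank_partition W \<Z> \<and> canonical \<Z> = \<Z>}"

definition id_map ::
    "'w topology \<Rightarrow> ('w set, 'w) labelled_family \<Rightarrow> ('w set, 'w) labelled_family" where
  "id_map W \<Y> = canonical (ideal_completion W \<Y>)"

definition clean_interior_map ::
    "'w topology \<Rightarrow> ('w set, 'w) labelled_family \<Rightarrow> ('w set, 'w) labelled_family" where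
  "clean_interior_map W \<Z> = canonical (clean_interior W \<Z>)"

lemma canonical_mem_trim_partitions:
  assumes "trim_partition W \<X>"
  shows "canonical \<X> \<in> trim_partitions W"
proof -
  have "P_partition W \<X>" using assms by (simp add: trim_partition_def)
  then show ?thesis
    using relabel_trim_partition[OF relabels_via_canonical assms] canonical_canonical
    by (simp add: trim_partitions_def)
qed

lemma canonical_mem_rank_partitions:
  assumes "rank_partition W \<X>"
  shows "canonical \<X> \<in> rank_partitions W"
proof -
  have "P_partition W \<X>" using assms by (simp add: rank_partition_def)
  then show ?thesis
    using relabel_rank_partition[OF relabels_via_canonical assms] canonical_canonical
    by (simp add: rank_partitions_def)
qed

lemma id_map_canonical:
  assumes "P_partition W \<X>"
  shows "id_map W (canonical \<X>) = canonical (ideal_completion W \<X>)"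
proof -
  have "ideal_completion W \<X> \<simeq>\<^sub>r ideal_completion W (canonical \<X>)"
    unfolding same_up_to_relabelling_def
    by (rule exI) (rule relabel_ideal_completion[OF relabels_via_canonical[OF assms]])
  then show ?thesis
    unfolding id_map_def by (rule canonical_cong[symmetric])
qed

lemma clean_interior_map_canonical:
  assumes "P_partition W \<X>"
  shows "clean_interior_map W (canonical \<X>) = canonical (clean_interior W \<X>)"
proof -
  have "clean_interior W \<X> \<simeq>\<^sub>r clean_interior W (canonical \<X>)"
    unfolding same_up_to_relabelling_def
    by (rule exI) (rule relabel_clean_interior[OF relabels_via_canonical[OF assms]])
  then show ?thesis
    unfolding clean_interior_map_def by (rule canonical_cong[symmetric])
qed

end

theory Submission
  imports Defs "HOL-Library.Ramsey"
begin

text \<open>Throughout, \<open>I\<^sub>w\<close> is the set of labels of the trim sets that contain the point \<open>w\<close>, and \<open>\<tau> w\<close> is the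
label of \<open>w\<close> in a complete partition.  In a \<open>P\<close>-partition the order of the labels is visible in
the topology: \<open>p \<le> q\<close> means that the block of \<open>p\<close> lies in the closure of the block of \<open>q\<close>.

From a trim partition to a rank partition.  The trim sets around a point form a neighbourhood base,
so \<open>I\<^sub>w\<close> is an ideal (\<open>po_ideal_I\<close>).  Since there are only countably many compact open sets, a trim
set whose label belongs to an ideal \<open>J\<close> can be shrunk, along a cofinal increasing sequence of labels
in \<open>J\<close>, to a single point \<open>w\<close>, and then \<open>I\<^sub>w = J\<close> (\<open>ideal_realized\<close>).  This says both that every
ideal occurs and that the points with \<open>I\<^sub>w = J\<close> accumulate wherever they should
(\<open>limit_point_completion\<close>).  An ideal is separated exactly if it is principal, that is, generated by
some \<open>p\<close>, and then \<open>p \<in> I\<^sub>w\<close> is an open condition on \<open>w\<close>; this is the first axiom of rank partitions.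
A point with a non-principal \<open>I\<^sub>w\<close> is a limit of points of the trim partition, whose labels are
principal ideals strictly contained in \<open>I\<^sub>w\<close>; this is the second axiom (\<open>rank_completion\<close>).  Only principal ideals have trim sets, so taking the clean
interior restores the original partition.

From a rank partition to a trim partition.  Two facts about separated labels carry the argument.  For
a separated \<open>q\<close> the points with label at least \<open>q\<close> form an open set: by Ramsey's theorem a sequence
converging to such a point from outside has a subsequence with labels that are incomparable,
increasing or weakly decreasing; the first axiom excludes the first two kinds, and the closure
relation between blocks excludes the third (\<open>openin_labels_above_separated\<close>).  Moreover, every
compact open set containing \<open>w\<close> has a point whose label is separated and at most \<open>\<tau> w\<close>: a minimal
label exists by compactness and Zorn's lemma, and the second axiom makes it separated
(\<open>ex_separated_label_below\<close>).  Together they show that the separated labels are those that have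
trim sets and that their points are the clean ones.  The second fact supplies trim sets around all the
other points, and shows that \<open>w\<close> lies in the closure of the block of \<open>p\<close> as soon as all separated labels
below \<open>\<tau> w\<close> are below \<open>p\<close>.  Hence a label is determined by the set of separated labels below it,
which for the label \<open>\<tau> w\<close> is \<open>I\<^sub>w\<close>, and completing the clean interior restores the original partition.\<close>

section \<open>PO systems and their ideals\<close>

lemma po_le_refl: "p \<in> pts P \<Longrightarrow> po_le P p p"
  by (simp add: po_le_def)

lemma po_le_mem: "po_le P p q \<Longrightarrow> p \<in> pts P" "po_le P p q \<Longrightarrow> q \<in> pts P"
  by (simp_all add: po_le_def)

lemma po_le_trans: "is_po_system P \<Longrightarrow> po_le P p q \<Longrightarrow> po_le P q r \<Longrightarrow> po_le P p r"
  unfolding is_po_system_def po_le_def by (metis transD)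

lemma po_le_antisym: "is_po_system P \<Longrightarrow> po_le P p q \<Longrightarrow> po_le P q p \<Longrightarrow> p = q"
  unfolding is_po_system_def po_le_def by (metis antisymD)

lemma is_po_system_restrict:
  assumes "is_po_system P"
  shows "is_po_system \<lparr>pts = Q, lt = lt P \<inter> Q \<times> Q\<rparr>"
proof -
  have "antisym (lt P)" "trans (lt P)" using assms by (simp_all add: is_po_system_def)
  then have "antisym (lt P \<inter> Q \<times> Q)" "trans (lt P \<inter> Q \<times> Q)"
    using antisym_subset[of "lt P \<inter> Q \<times> Q" "lt P"] trans_Restr by auto
  then show ?thesis by (simp add: is_po_system_def)
qed

lemma down_set_iff: "q \<in> down_set P p \<longleftrightarrow> po_le P q p"
  by (auto simp: down_set_def po_le_def)

lemma up_set_iff: "q \<in> up_set P p \<longleftrightarrow> po_le P p q"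
  by (auto simp: up_set_def po_le_def)

lemma po_ideal_mem: "po_ideal P J \<Longrightarrow> p \<in> J \<Longrightarrow> p \<in> pts P"
  unfolding po_ideal_def by blast

lemma po_ideal_nonempty: "po_ideal P J \<Longrightarrow> J \<noteq> {}"
  unfolding po_ideal_def by blast

lemma po_ideal_lower: "po_ideal P J \<Longrightarrow> q \<in> J \<Longrightarrow> po_le P p q \<Longrightarrow> p \<in> J"
  unfolding po_ideal_def by blast

lemma po_ideal_directed:
  assumes "po_ideal P J" "p \<in> J" "q \<in> J"
  obtains r where "r \<in> J" "po_le P p r" "po_le P q r"
  using assms unfolding po_ideal_def by blast

lemma po_ideal_down_set:
  assumes "is_po_system P" "p \<in> pts P"
  shows "po_ideal P (down_set P p)"
  unfolding po_ideal_def
proof (intro conjI ballI allI impI)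
  have p: "p \<in> down_set P p" using po_le_refl[OF assms(2)] by (simp add: down_set_iff)
  then show "down_set P p \<noteq> {}" by blast
  show "down_set P p \<subseteq> pts P" by (auto simp: down_set_def)
  show "y \<in> down_set P p" if "x \<in> down_set P p" "po_le P y x" for x y
    using that po_le_trans[OF assms(1)] unfolding down_set_iff by blast
  show "\<exists>z\<in>down_set P p. po_le P x z \<and> po_le P y z"
    if "x \<in> down_set P p" "y \<in> down_set P p" for x y
    using that p by (intro bexI[of _ p]) (simp_all add: down_set_iff)
qed

lemma down_set_subset_iff:
  assumes "is_po_system P" "p \<in> pts P"
  shows "down_set P p \<subseteq> down_set P q \<longleftrightarrow> po_le P p q"
  unfolding subset_iff down_set_iff
  using po_le_refl[OF assms(2)] po_le_trans[OF assms(1)] by blast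

lemma down_set_eq_iff:
  assumes "is_po_system P" "p \<in> pts P" "q \<in> pts P"
  shows "down_set P p = down_set P q \<longleftrightarrow> p = q"
proof
  assume "down_set P p = down_set P q"
  then have "po_le P p q" "po_le P q p"
    using down_set_subset_iff[OF assms(1)] assms(2,3) by blast+
  then show "p = q" by (rule po_le_antisym[OF assms(1)])
qed simp

lemma down_set_subset_ideal:
  "po_ideal P J \<Longrightarrow> p \<in> J \<Longrightarrow> down_set P p \<subseteq> J"
  using po_ideal_lower by (auto simp: down_set_iff)

lemma pts_id_po: "pts (id_po P) = {J. po_ideal P J}"
  by (simp add: id_po_def)

lemma po_le_id_po: "po_le (id_po P) J K \<longleftrightarrow> po_ideal P J \<and> po_ideal P K \<and> J \<subseteq> K"
  by (auto simp: po_le_def id_po_def)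

text \<open>The union of an increasing sequence of ideals is an ideal, hence their supremum.  If it has a
  generator, then the generator already lies in one of the ideals, so the sequence is eventually
  constant.\<close>

lemma principal_ideal_separated:
  assumes P: "is_po_system P" and p: "p \<in> pts P"
  shows "po_separated (id_po P) (down_set P p)"
  unfolding po_separated_def
proof (intro conjI notI)
  show "down_set P p \<in> pts (id_po P)"
    by (simp add: pts_id_po po_ideal_down_set[OF P p])
  assume "\<exists>s. (\<forall>n. po_less (id_po P) (s n) (s (Suc n))) \<and>
      is_po_sup (id_po P) (range s) (down_set P p)"
  then obtain s where s: "\<And>n. po_ideal P (s n)" "\<And>n. s n \<subset> s (Suc n)"
    and sup: "is_po_sup (id_po P) (range s) (down_set P p)"
    by (auto simp: po_less_def po_le_id_po)
  have mono: "s m \<subseteq> s n" if "m \<le> n" for m n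
    by (rule lift_Suc_mono_le[of s, OF _ that]) (simp add: psubset_imp_subset[OF s(2)])
  have "po_ideal P (\<Union>n. s n)"
    unfolding po_ideal_def
  proof (intro conjI ballI allI impI)
    show "(\<Union>n. s n) \<noteq> {}" "(\<Union>n. s n) \<subseteq> pts P"
      using po_ideal_nonempty[OF s(1)] po_ideal_mem[OF s(1)] by auto
    show "y \<in> (\<Union>n. s n)" if "x \<in> (\<Union>n. s n)" "po_le P y x" for x y
      using that po_ideal_lower[OF s(1)] by blast
    fix x y assume "x \<in> (\<Union>n. s n)" "y \<in> (\<Union>n. s n)"
    then obtain m n where "x \<in> s m" "y \<in> s n" by blast
    then have "x \<in> s (max m n)" "y \<in> s (max m n)"
      using mono[of m "max m n"] mono[of n "max m n"] by auto
    then obtain z where "z \<in> s (max m n)" "po_le P x z" "po_le P y z"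
      by (rule po_ideal_directed[OF s(1)])
    then show "\<exists>z\<in>\<Union>n. s n. po_le P x z \<and> po_le P y z"
      by blast
  qed
  then have "(\<Union>n. s n) \<in> pts (id_po P)" "\<forall>t\<in>range s. po_le (id_po P) t (\<Union>n. s n)"
    using s(1) by (auto simp: pts_id_po po_le_id_po)
  then have "down_set P p \<subseteq> (\<Union>n. s n)"
    using sup unfolding is_po_sup_def by (simp add: po_le_id_po)
  then obtain n where "p \<in> s n"
    using po_le_refl[OF p] by (auto simp: down_set_iff)
  then have "down_set P p \<subseteq> s n"
    by (rule down_set_subset_ideal[OF s(1)])
  moreover have "s (Suc n) \<subseteq> down_set P p"
    using sup by (auto simp: is_po_sup_def po_le_id_po)
  ultimately show False using s(2)[of n] by blast
qed

text \<open>A countable directed set has a cofinal increasing sequence.  If the ideal has no generator, the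
  sequence can be made strictly increasing, and the principal ideals along it show that the ideal is
  not separated.\<close>

lemma separated_ideal_principal:
  assumes P: "is_po_system P" and J: "po_separated (id_po P) J" "countable J"
  shows "\<exists>p\<in>pts P. J = down_set P p"
proof (rule ccontr)
  assume np: "\<not> ?thesis"
  have iJ: "po_ideal P J"
    using J by (simp add: po_separated_def pts_id_po)
  then have ne: "J \<noteq> {}" and sub: "J \<subseteq> pts P"
    using po_ideal_nonempty[OF iJ] po_ideal_mem[OF iJ] by auto
  define e where "e = from_nat_into J"
  have e: "range e = J"
    unfolding e_def using ne J(2) by (rule range_from_nat_into)
  have step: "\<exists>r'. r' \<in> J \<and> po_le P r r' \<and> po_le P (e n) r' \<and> r' \<noteq> r" if r: "r \<in> J" for r n
  proof -
    have "down_set P r \<subseteq> J" "down_set P r \<noteq> J"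
      using np r sub down_set_subset_ideal[OF iJ r] by auto
    then obtain q where "q \<in> J" "q \<notin> down_set P r"
      by blast
    then have q: "q \<in> J" "\<not> po_le P q r"
      by (simp_all add: down_set_iff)
    have "e n \<in> J" using e by auto
    then obtain a where a: "a \<in> J" "po_le P r a" "po_le P (e n) a"
      by (rule po_ideal_directed[OF iJ r])
    obtain b where b: "b \<in> J" "po_le P a b" "po_le P q b"
      using a(1) q(1) by (rule po_ideal_directed[OF iJ])
    have "po_le P r b" "po_le P (e n) b" "b \<noteq> r"
      using po_le_trans[OF P _ b(2)] a b(3) q(2) by auto
    then show ?thesis using b(1) by blast
  qed
  have "\<exists>r. \<forall>n. r n \<in> J \<and>
      (po_le P (r n) (r (Suc n)) \<and> po_le P (e n) (r (Suc n)) \<and> r (Suc n) \<noteq> r n)"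
    using dependent_nat_choice[of "\<lambda>_ r. r \<in> J"
        "\<lambda>n r r'. po_le P r r' \<and> po_le P (e n) r' \<and> r' \<noteq> r"] ne step by blast
  then obtain r where r: "\<And>n. r n \<in> J" "\<And>n. po_le P (r n) (r (Suc n))"
    "\<And>n. po_le P (e n) (r (Suc n))" "\<And>n. r (Suc n) \<noteq> r n"
    by blast
  have rp: "r n \<in> pts P" for n
    using r(1) sub by blast
  define s where "s n = down_set P (r n)" for n
  have "po_less (id_po P) (s n) (s (Suc n))" for n
    using r(2)[of n] r(4)[of n] rp unfolding po_less_def po_le_id_po s_def
    by (simp add: po_ideal_down_set[OF P] down_set_subset_iff[OF P] down_set_eq_iff[OF P])
  moreover have "is_po_sup (id_po P) (range s) J"
    unfolding is_po_sup_def
  proof (intro conjI ballI impI)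
    show "J \<in> pts (id_po P)" using iJ by (simp add: pts_id_po)
    show "po_le (id_po P) t J" if "t \<in> range s" for t
      using that iJ rp r(1) by (auto simp: po_le_id_po s_def po_ideal_down_set[OF P]
          dest: down_set_subset_ideal[OF iJ, THEN subsetD])
    fix u assume u: "u \<in> pts (id_po P)" "\<forall>t\<in>range s. po_le (id_po P) t u"
    have "e n \<in> u" for n
      using u(2) r(3)[of n] by (auto simp: po_le_id_po s_def down_set_iff subset_iff)
    then show "po_le (id_po P) J u"
      using u(1) iJ e by (auto simp: po_le_id_po pts_id_po)
  qed
  ultimately show False
    using J(1) unfolding po_separated_def by blast
qed


section \<open>Compact open sets\<close>

lemma compactin_Int_chain_nonempty:
  assumes K: "compactin X K" "K \<noteq> {}"
    and C: "\<And>C. C \<in> \<C> \<Longrightarrow> closedin X C \<and> K \<inter> C \<noteq> {}"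
    and chain: "\<And>C D. C \<in> \<C> \<Longrightarrow> D \<in> \<C> \<Longrightarrow> C \<subseteq> D \<or> D \<subseteq> C"
  shows "K \<inter> \<Inter>\<C> \<noteq> {}"
proof -
  have least: "\<Inter>\<F> \<in> \<F>" if "finite \<F>" "\<F> \<noteq> {}" "\<F> \<subseteq> \<C>" for \<F>
    using that
  proof (induction rule: finite_ne_induct)
    case (insert C \<F>)
    then have "\<Inter>\<F> \<in> \<F>" "C \<in> \<C>" by auto
    then have "C \<subseteq> \<Inter>\<F> \<or> \<Inter>\<F> \<subseteq> C" using chain insert by blast
    then show ?case using \<open>\<Inter>\<F> \<in> \<F>\<close> by (auto simp: Int_absorb1 Int_absorb2)
  qed simp
  have "K \<inter> \<Inter>\<F> \<noteq> {}" if "finite \<F>" "\<F> \<subseteq> \<C>" for \<F>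
  proof (cases "\<F> = {}")
    case False
    then show ?thesis using least[OF that(1) False that(2)] that(2) C by blast
  qed (use K(2) in simp)
  moreover have "\<forall>C\<in>\<C>. closedin X C" using C by blast
  ultimately show ?thesis
    using K(1) by (simp add: compactin_fip)
qed

locale omega_stone =
  fixes W :: "'w topology"
  assumes omega_stone: "omega_stone_space W"
begin

lemma Hausdorff: "Hausdorff_space W"
  using omega_stone by (simp add: omega_stone_space_def stone_space_def)

lemma compact_opens_closedin: "A \<in> compact_opens W \<Longrightarrow> closedin W A"
  using Hausdorff by (simp add: compact_opens_def compactin_imp_closedin)

lemma compact_opens_openin: "A \<in> compact_opens W \<Longrightarrow> openin W A"
  by (simp add: compact_opens_def)

lemma compact_opens_topspace: "A \<in> compact_opens W \<Longrightarrow> w \<in> A \<Longrightarrow> w \<in> topspace W"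
  using compact_opens_openin openin_subset by blast

lemma compact_opens_Un: "A \<in> compact_opens W \<Longrightarrow> B \<in> compact_opens W \<Longrightarrow> A \<union> B \<in> compact_opens W"
  by (simp add: compact_opens_def compactin_Un openin_Un)

lemma compact_opens_Int: "A \<in> compact_opens W \<Longrightarrow> B \<in> compact_opens W \<Longrightarrow> A \<inter> B \<in> compact_opens W"
  using compact_opens_closedin[of A]
  by (simp add: compact_opens_def closed_Int_compactin openin_Int)

lemma compact_opens_Diff: "A \<in> compact_opens W \<Longrightarrow> B \<in> compact_opens W \<Longrightarrow> A - B \<in> compact_opens W"
proof -
  assume A: "A \<in> compact_opens W" and B: "B \<in> compact_opens W"
  have "closedin W (A - B)" "openin W (A - B)"
    using A B compact_opens_closedin compact_opens_openin by (simp_all add: closedin_diff openin_diff)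
  moreover have "compactin W A" using A by (simp add: compact_opens_def)
  ultimately show "A - B \<in> compact_opens W"
    using closed_compactin[of W A "A - B"] by (auto simp: compact_opens_def)
qed

lemma ex_compact_open:
  assumes "openin W U" "w \<in> U"
  obtains A where "A \<in> compact_opens W" "w \<in> A" "A \<subseteq> U"
  using omega_stone assms unfolding omega_stone_space_def stone_space_def by blast

lemma ex_compact_open_avoiding:
  assumes "openin W U" "w \<in> U" "x \<in> topspace W" "x \<noteq> w"
  obtains A where "A \<in> compact_opens W" "w \<in> A" "A \<subseteq> U" "x \<notin> A"
proof -
  have "openin W (U - {x})"
    using assms(1,3) Hausdorff by (simp add: openin_diff closedin_Hausdorff_sing_eq)
  moreover have "w \<in> U - {x}"
    using assms(2,4) by simp
  ultimately obtain A where "A \<in> compact_opens W" "w \<in> A" "A \<subseteq> U - {x}"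
    by (rule ex_compact_open)
  then show thesis
    by (intro that) auto
qed

definition enum :: "nat \<Rightarrow> 'w set" where
  "enum = from_nat_into (compact_opens W)"

lemma range_enum: "range enum = compact_opens W"
proof -
  have "{} \<in> compact_opens W" by (simp add: compact_opens_def)
  moreover have "countable (compact_opens W)"
    using omega_stone by (simp add: omega_stone_space_def)
  ultimately show ?thesis
    unfolding enum_def by (intro range_from_nat_into) auto
qed

text \<open>If for every compact open set some member of the decreasing sequence lies inside it or misses it,
  then the sequence shrinks to a single point: any point of the intersection has the sequence as a neighbourhood base.\<close>

lemma nested_compact_opens_base:
  assumes A: "\<And>n. A n \<in> compact_opens W" "\<And>n. A n \<noteq> {}" "\<And>n. A (Suc n) \<subseteq> A n"
    and decide: "\<And>n. A (Suc n) \<subseteq> enum n \<or> A (Suc n) \<inter> enum n = {}"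
  obtains w where "\<And>n. w \<in> A n" "\<And>U. openin W U \<Longrightarrow> w \<in> U \<Longrightarrow> \<exists>n. A n \<subseteq> U"
proof -
  have anti: "A n \<subseteq> A m" if "m \<le> n" for m n
    by (rule lift_Suc_antimono_le[of A, OF A(3) that])
  have "A 0 \<inter> \<Inter>(range A) \<noteq> {}"
  proof (rule compactin_Int_chain_nonempty)
    show "compactin W (A 0)" "A 0 \<noteq> {}"
      using A by (auto simp: compact_opens_def)
    show "closedin W C \<and> A 0 \<inter> C \<noteq> {}" if "C \<in> range A" for C
    proof -
      obtain n where "C = A n" using \<open>C \<in> range A\<close> by blast
      then show ?thesis
        using compact_opens_closedin[OF A(1)] anti[of 0 n] A(2)[of n] by (simp add: Int_absorb1)
    qed
    show "C \<subseteq> D \<or> D \<subseteq> C" if "C \<in> range A" "D \<in> range A" for C D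
    proof -
      obtain m n where "C = A m" "D = A n" using \<open>C \<in> range A\<close> \<open>D \<in> range A\<close> by blast
      then show ?thesis using anti[of m n] anti[of n m] nat_le_linear[of m n] by blast
    qed
  qed
  then obtain w where w: "\<And>n. w \<in> A n" by blast
  have "\<exists>n. A n \<subseteq> U" if U: "openin W U" "w \<in> U" for U
  proof -
    obtain B where B: "B \<in> compact_opens W" "w \<in> B" "B \<subseteq> U"
      using ex_compact_open[OF U] .
    then obtain n where "B = enum n" using range_enum by blast
    then have "A (Suc n) \<subseteq> B" using decide[of n] w[of "Suc n"] B(2) by blast
    then show ?thesis using B(3) by blast
  qed
  with w that show thesis by blast
qed

lemma closure_of_sequence:
  assumes "w \<in> W closure_of S"
  obtains xs :: "nat \<Rightarrow> 'w" where "range xs \<subseteq> S" "limitin W xs w sequentially"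
proof -
  have w: "w \<in> topspace W"
    using assms by (simp add: in_closure_of)
  define U where "U n = topspace W \<inter> \<Inter>{enum k |k. k \<le> n \<and> w \<in> enum k}" for n
  have en: "openin W (enum k)" for k
    using range_enum compact_opens_openin by blast
  have "openin W (U n)" for n
  proof -
    have "{enum k |k. k \<le> n \<and> w \<in> enum k} = enum ` {k. k \<le> n \<and> w \<in> enum k}" by auto
    then show ?thesis
      unfolding U_def using en by (auto intro!: openin_Int_Inter)
  qed
  moreover have "w \<in> U n" for n
    using w by (auto simp: U_def)
  ultimately have "\<forall>n. \<exists>x. x \<in> S \<and> x \<in> U n"
    using assms by (auto simp: in_closure_of)
  then obtain xs where xs: "\<And>n. xs n \<in> S" "\<And>n. xs n \<in> U n" by metis
  have "limitin W xs w sequentially"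
    unfolding limitin_sequentially
  proof (intro conjI allI impI w)
    fix V assume "openin W V \<and> w \<in> V"
    then obtain B where "B \<in> compact_opens W" "w \<in> B" "B \<subseteq> V"
      using ex_compact_open by blast
    moreover from this obtain k where "B = enum k" using range_enum by blast
    ultimately have "xs n \<in> V" if "k \<le> n" for n
      using xs(2)[of n] that by (auto simp: U_def)
    then show "\<exists>N. \<forall>n\<ge>N. xs n \<in> V" by blast
  qed
  then show thesis using that xs(1) by blast
qed

end

section \<open>Blocks and trim sets of a partition\<close>

context
  fixes W :: "'w topology" and \<X> :: "('p, 'w) labelled_family"
  assumes part: "P_partition W \<X>"
begin

lemma partition_po: "is_po_system (index \<X>)"
  using part by (simp add: P_partition_def)

lemma block_unique:
  "w \<in> block \<X> p \<Longrightarrow> w \<in> block \<X> q \<Longrightarrow> p \<in> pts (index \<X>) \<Longrightarrow> q \<in> pts (index \<X>) \<Longrightarrow> p = q"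
  using part unfolding P_partition_def disjoint_family_on_def by blast

lemma block_topspace: "p \<in> pts (index \<X>) \<Longrightarrow> block \<X> p \<subseteq> topspace W"
  using part by (simp add: P_partition_def)

lemma block_nonempty: "p \<in> pts (index \<X>) \<Longrightarrow> block \<X> p \<noteq> {}"
  using part by (simp add: P_partition_def)

lemma lt_iff_limit_point:
  assumes "w \<in> block \<X> p" "p \<in> pts (index \<X>)" "q \<in> pts (index \<X>)"
  shows "(p, q) \<in> lt (index \<X>) \<longleftrightarrow> w \<in> W derived_set_of block \<X> q"
proof -
  have "w \<in> support \<X>" using assms by (auto simp: support_def)
  then have "w \<in> W derived_set_of block \<X> q \<longleftrightarrow>
      w \<in> (\<Union>r\<in>{r \<in> pts (index \<X>). (r, q) \<in> lt (index \<X>)}. block \<X> r)"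
    using part assms(3) unfolding P_partition_def by blast
  also have "\<dots> \<longleftrightarrow> (p, q) \<in> lt (index \<X>)"
    using assms block_unique by blast
  finally show ?thesis ..
qed

lemma le_iff_closure:
  assumes "w \<in> block \<X> p" "p \<in> pts (index \<X>)" "q \<in> pts (index \<X>)"
  shows "po_le (index \<X>) p q \<longleftrightarrow> w \<in> W closure_of block \<X> q"
proof -
  have "w \<in> block \<X> q \<longleftrightarrow> p = q"
    using assms block_unique by blast
  then show ?thesis
    using lt_iff_limit_point[OF assms] assms block_topspace[OF assms(2)]
    unfolding po_le_def closure_of by blast
qed

lemma label_eqI:
  assumes "w \<in> block \<X> p" "p \<in> pts (index \<X>)"
  shows "label \<X> w = p"
  unfolding label_def using assms block_unique by blast

text \<open>The upper labels survive in \<open>B\<close> because every block with label above \<open>p\<close> accumulates at the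
  point \<open>w\<close>.\<close>

lemma p_trim_shrink:
  assumes A: "p_trim W \<X> p A" and w: "w \<in> block \<X> p" "w \<in> B"
    and B: "B \<in> compact_opens W" "B \<subseteq> A"
  shows "p_trim W \<X> p B"
  unfolding p_trim_def
proof (intro conjI impI set_eqI iffI)
  show p: "p \<in> pts (index \<X>)" and "B \<in> compact_opens W"
    using A B by (auto simp: p_trim_def)
  show "q \<in> up_set (index \<X>) p" if "q \<in> {q \<in> pts (index \<X>). B \<inter> block \<X> q \<noteq> {}}" for q
  proof -
    have "q \<in> {q \<in> pts (index \<X>). A \<inter> block \<X> q \<noteq> {}}" using that B(2) by blast
    then show ?thesis using A unfolding p_trim_def by blast
  qed
  show "q \<in> {q \<in> pts (index \<X>). B \<inter> block \<X> q \<noteq> {}}" if "q \<in> up_set (index \<X>) p" for q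
  proof -
    have q: "po_le (index \<X>) p q" "q \<in> pts (index \<X>)"
      using that by (auto simp: up_set_def)
    then have "w \<in> W closure_of block \<X> q"
      using le_iff_closure[OF w(1) p] by blast
    moreover have "openin W B" using B by (simp add: compact_opens_def)
    ultimately show ?thesis using w(2) q(2) unfolding in_closure_of by blast
  qed
  assume "p \<in> pts_d (index \<X>)"
  then have "card (A \<inter> block \<X> p) = 1" using A by (simp add: p_trim_def)
  then obtain a where a: "A \<inter> block \<X> p = {a}" by (auto simp: card_1_singleton_iff)
  have "w \<in> A \<inter> block \<X> p" using w B(2) by auto
  then have "w = a" unfolding a by simp
  then have "B \<inter> block \<X> p = {w}" using a w B(2) by auto
  then show "card (B \<inter> block \<X> p) = 1" by simp
qed

end

lemma p_trim_iff_le: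
  assumes "p_trim W \<X> p A" "q \<in> pts (index \<X>)"
  shows "A \<inter> block \<X> q \<noteq> {} \<longleftrightarrow> po_le (index \<X>) p q"
proof -
  have "{q \<in> pts (index \<X>). A \<inter> block \<X> q \<noteq> {}} = up_set (index \<X>) p"
    using assms(1) by (simp add: p_trim_def)
  then have "q \<in> {q \<in> pts (index \<X>). A \<inter> block \<X> q \<noteq> {}} \<longleftrightarrow> po_le (index \<X>) p q"
    by (simp add: up_set_iff)
  then show ?thesis using assms(2) by simp
qed

lemma p_trim_le:
  "p_trim W \<X> p A \<Longrightarrow> w \<in> A \<Longrightarrow> w \<in> block \<X> q \<Longrightarrow> q \<in> pts (index \<X>) \<Longrightarrow> po_le (index \<X>) p q"
  using p_trim_iff_le[of W \<X> p A q] by auto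

lemma p_trim_meets:
  assumes "p_trim W \<X> p A" "po_le (index \<X>) p q"
  obtains w where "w \<in> A" "w \<in> block \<X> q"
proof -
  have "A \<inter> block \<X> q \<noteq> {}"
    using p_trim_iff_le[OF assms(1) po_le_mem(2)[OF assms(2)]] assms(2) by simp
  then show thesis using that by auto
qed

lemma p_trim_mem: "p_trim W \<X> p A \<Longrightarrow> p \<in> pts (index \<X>)"
  by (simp add: p_trim_def)

lemma p_trim_compact_open: "p_trim W \<X> p A \<Longrightarrow> A \<in> compact_opens W"
  by (simp add: p_trim_def)

lemma p_trim_openin: "p_trim W \<X> p A \<Longrightarrow> openin W A"
  by (simp add: p_trim_def compact_opens_def)

lemma p_trim_topspace: "p_trim W \<X> p A \<Longrightarrow> w \<in> A \<Longrightarrow> w \<in> topspace W"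
  using p_trim_openin[of W \<X> p A] openin_subset[of W A] by auto

lemma p_trim_meets_own_block:
  assumes "p_trim W \<X> p A"
  obtains w where "w \<in> A" "w \<in> block \<X> p"
  using p_trim_meets[OF assms po_le_refl[OF p_trim_mem[OF assms]]] .

lemma p_trim_unique:
  assumes "P_partition W \<X>" "p_trim W \<X> p A" "p_trim W \<X> q A"
  shows "p = q"
proof -
  have "up_set (index \<X>) p = up_set (index \<X>) q" and m: "p \<in> pts (index \<X>)" "q \<in> pts (index \<X>)"
    using assms(2,3) by (simp_all add: p_trim_def)
  then have "po_le (index \<X>) p r \<longleftrightarrow> po_le (index \<X>) q r" for r
    by (simp flip: up_set_iff)
  then have "po_le (index \<X>) q p" "po_le (index \<X>) p q"
    using po_le_refl[OF m(1)] po_le_refl[OF m(2)] by blast+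
  then show ?thesis using po_le_antisym[OF partition_po[OF assms(1)]] by simp
qed

lemma (in omega_stone) p_trim_extend:
  assumes A: "p_trim W \<X> p A" and B: "B \<in> compact_opens W"
    and le: "\<And>q. q \<in> pts (index \<X>) \<Longrightarrow> B \<inter> block \<X> q \<noteq> {} \<Longrightarrow> po_le (index \<X>) p q"
    and d: "p \<in> pts_d (index \<X>) \<Longrightarrow> B \<inter> block \<X> p = {}"
  shows "p_trim W \<X> p (A \<union> B)"
proof -
  have "{q \<in> pts (index \<X>). (A \<union> B) \<inter> block \<X> q \<noteq> {}} = up_set (index \<X>) p"
    using A le unfolding p_trim_def up_set_def by blast
  moreover have "(A \<union> B) \<inter> block \<X> p = A \<inter> block \<X> p" if "p \<in> pts_d (index \<X>)"
    using d[OF that] by blast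
  ultimately show ?thesis
    using A compact_opens_Un[OF _ B] by (simp add: p_trim_def)
qed


section \<open>The ideal completion of a trim partition\<close>

locale trim_partitioned = omega_stone W
  for W :: "'w topology" +
  fixes \<Y> :: "('p, 'w) labelled_family"
  assumes trim: "trim_partition W \<Y>"
begin

abbreviation P where "P \<equiv> index \<Y>"
abbreviation I where "I \<equiv> trim_labels W \<Y>"

lemma part: "P_partition W \<Y>"
  using trim by (simp add: trim_partition_def)

lemmas P_po = partition_po[OF part]

lemma trim_neighbourhood:
  assumes "openin W U" "w \<in> U"
  obtains p A where "p_trim W \<Y> p A" "w \<in> A" "A \<subseteq> U"
proof -
  have "w \<in> topspace W" using assms openin_subset by blast
  then show thesis
    using trim assms that unfolding trim_partition_def trim_set_def by metis
qed

lemma p_trim_neighbourhood: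
  assumes "p \<in> pts P" "w \<in> block \<Y> p" "openin W U" "w \<in> U"
  obtains A where "p_trim W \<Y> p A" "w \<in> A" "A \<subseteq> U"
proof -
  have "w \<in> support \<Y>" using assms by (auto simp: support_def)
  then have "clean_point W \<Y> w" using trim by (simp add: trim_partition_def)
  then obtain q B where q: "q \<in> pts P" "w \<in> block \<Y> q" and B: "p_trim W \<Y> q B" "w \<in> B"
    by (auto simp: clean_point_def)
  have "q = p" by (rule block_unique[OF part q(2) assms(2) q(1) assms(1)])
  have "openin W (B \<inter> U)"
    using assms(3) p_trim_openin[OF B(1)] by (simp add: openin_Int)
  moreover have "w \<in> B \<inter> U" using B(2) assms(4) by simp
  ultimately obtain A where A: "A \<in> compact_opens W" "w \<in> A" "A \<subseteq> B \<inter> U"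
    by (rule ex_compact_open)
  then have "p_trim W \<Y> p A"
    using p_trim_shrink[OF part B(1) q(2)] \<open>q = p\<close> by simp
  then show thesis using A that by simp
qed

lemma ex_p_trim:
  assumes "p \<in> pts P"
  obtains A where "p_trim W \<Y> p A"
proof -
  obtain w where w: "w \<in> block \<Y> p" using block_nonempty[OF part assms] by blast
  then have "w \<in> topspace W" using block_topspace[OF part assms] by blast
  then show thesis
    using p_trim_neighbourhood[OF assms w openin_topspace] that by metis
qed

lemma mem_I: "p \<in> I w \<longleftrightarrow> (\<exists>A. p_trim W \<Y> p A \<and> w \<in> A)"
  by (simp add: trim_labels_def)

lemma I_le_block: "p \<in> I w \<Longrightarrow> w \<in> block \<Y> q \<Longrightarrow> q \<in> pts P \<Longrightarrow> po_le P p q"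
  using p_trim_le by (auto simp: mem_I)

text \<open>Let \<open>q \<le> p\<close> be distinct labels.  A \<open>p\<close>-trim set has no point with label \<open>q\<close>; adjoining it to a
  \<open>q\<close>-trim set therefore gives a \<open>q\<close>-trim set again, so \<open>I\<^sub>w\<close> is a lower set.  It is directed because a trim neighbourhood of
  \<open>w\<close> inside the intersection of a \<open>p\<close>-trim and a \<open>q\<close>-trim set bounds both labels.\<close>

lemma po_ideal_I:
  assumes w: "w \<in> topspace W"
  shows "po_ideal P (I w)"
  unfolding po_ideal_def
proof (intro conjI ballI allI impI)
  show "I w \<noteq> {}"
    using trim_neighbourhood[OF openin_topspace w] mem_I by (metis empty_iff)
  show "I w \<subseteq> pts P"
    using p_trim_mem by (auto simp: mem_I)
  show "q \<in> I w" if p: "p \<in> I w" and qp: "po_le P q p" for p q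
  proof (cases "q = p")
    case False
    obtain A where A: "p_trim W \<Y> p A" "w \<in> A" using p mem_I by blast
    obtain B where B: "p_trim W \<Y> q B" using ex_p_trim[OF po_le_mem(1)[OF qp]] .
    have le: "po_le P p r" if "r \<in> pts P" "A \<inter> block \<Y> r \<noteq> {}" for r
      using p_trim_iff_le[OF A(1)] that by simp
    have "p_trim W \<Y> q (B \<union> A)"
    proof (rule p_trim_extend[OF B p_trim_compact_open[OF A(1)]])
      show "po_le P q r" if "r \<in> pts P" "A \<inter> block \<Y> r \<noteq> {}" for r
        using po_le_trans[OF P_po qp le[OF that]] .
      show "A \<inter> block \<Y> q = {}"
      proof (rule ccontr)
        assume "A \<inter> block \<Y> q \<noteq> {}"
        then have "po_le P p q" by (rule le[OF po_le_mem(1)[OF qp]])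
        then show False using po_le_antisym[OF P_po qp] False by simp
      qed
    qed
    then show ?thesis using A(2) by (auto simp: mem_I)
  qed (use p in simp)
  show "\<exists>r\<in>I w. po_le P p r \<and> po_le P q r" if pq: "p \<in> I w" "q \<in> I w" for p q
  proof -
    obtain A where A: "p_trim W \<Y> p A" "w \<in> A" using pq(1) unfolding mem_I by blast
    obtain B where B: "p_trim W \<Y> q B" "w \<in> B" using pq(2) unfolding mem_I by blast
    have "openin W (A \<inter> B)"
      using A B p_trim_compact_open compact_opens_openin openin_Int by metis
    moreover have "w \<in> A \<inter> B" using A B by simp
    ultimately obtain r C where C: "p_trim W \<Y> r C" "w \<in> C" "C \<subseteq> A \<inter> B"
      by (rule trim_neighbourhood)
    obtain c where c: "c \<in> C" "c \<in> block \<Y> r"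
      using p_trim_meets_own_block[OF C(1)] .
    then have "po_le P p r" "po_le P q r"
      using p_trim_le[OF A(1) _ c(2)] p_trim_le[OF B(1) _ c(2)] C p_trim_mem[OF C(1)] by auto
    then show ?thesis using C mem_I by blast
  qed
qed

lemma I_block:
  assumes "p \<in> pts P" "w \<in> block \<Y> p"
  shows "I w = down_set P p"
proof
  show "I w \<subseteq> down_set P p"
    using I_le_block assms by (auto simp: down_set_iff)
  have w: "w \<in> topspace W" using block_topspace[OF part assms(1)] assms(2) by blast
  then have "p \<in> I w"
    using p_trim_neighbourhood[OF assms openin_topspace] mem_I by metis
  then show "down_set P p \<subseteq> I w"
    by (rule down_set_subset_ideal[OF po_ideal_I[OF w]])
qed

text \<open>If \<open>I\<^sub>w\<close> is principal with generator \<open>p\<close>, then small trim neighbourhoods of \<open>w\<close> must be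
  \<open>p\<close>-trim, and this is where the second axiom of trim partitions places \<open>w\<close> in the block of
  \<open>p\<close>.\<close>

lemma block_iff_I:
  assumes p: "p \<in> pts P" and w: "w \<in> topspace W"
  shows "w \<in> block \<Y> p \<longleftrightarrow> I w = down_set P p"
proof
  assume I: "I w = down_set P p"
  then have "p \<in> I w" using po_le_refl[OF p] by (simp add: down_set_iff)
  then obtain A where A: "p_trim W \<Y> p A" "w \<in> A" using mem_I by blast
  have "\<exists>C. p_trim W \<Y> p C \<and> w \<in> C \<and> C \<subseteq> U" if U: "openin W U" "w \<in> U" for U
  proof -
    have "openin W (A \<inter> U)"
      using U(1) p_trim_openin[OF A(1)] by (simp add: openin_Int)
    moreover have "w \<in> A \<inter> U" using A(2) U(2) by simp
    ultimately obtain r C where C: "p_trim W \<Y> r C" "w \<in> C" "C \<subseteq> A \<inter> U"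
      by (rule trim_neighbourhood)
    have "r \<in> I w" using C mem_I by blast
    then have "po_le P r p" by (simp add: I down_set_iff)
    moreover obtain c where "c \<in> C" "c \<in> block \<Y> r"
      using p_trim_meets_own_block[OF C(1)] .
    then have "po_le P p r"
      using p_trim_le[OF A(1)] C(3) p_trim_mem[OF C(1)] by blast
    ultimately have "r = p" by (rule po_le_antisym[OF P_po])
    then show ?thesis using C by blast
  qed
  moreover have "p \<in> P_hat W \<Y>" using p A by (auto simp: P_hat_def)
  ultimately show "w \<in> block \<Y> p"
    using trim w unfolding trim_partition_def by simp
qed (rule I_block[OF p])

lemma countable_P: "countable (pts P)"
proof -
  have "\<forall>p\<in>pts P. \<exists>A. p_trim W \<Y> p A" using ex_p_trim by metis
  then obtain g where g: "\<And>p. p \<in> pts P \<Longrightarrow> p_trim W \<Y> p (g p)" by metis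
  have "inj_on g (pts P)"
    using p_trim_unique[OF part] g by (metis inj_onI)
  moreover have "g ` pts P \<subseteq> range enum"
    unfolding range_enum using p_trim_compact_open[OF g] by auto
  ultimately show ?thesis
    using countable_image_inj_on countable_subset by (metis countable_image countableI_type)
qed

text \<open>Every ideal is of the form \<open>I\<^sub>w\<close>, and \<open>w\<close> can be found in any given trim set whose label
  belongs to the ideal: shrink trim sets along a cofinal increasing sequence in \<open>J\<close>, deciding all
  compact open sets on the way, so that the trim sets form a neighbourhood base of the one point
  that they share.\<close>

lemma ideal_realized:
  assumes J: "po_ideal P J" and p: "p \<in> J" and A: "p_trim W \<Y> p A"
  shows "\<exists>w\<in>A. I w = J"
proof -
  have sub: "J \<subseteq> pts P" using po_ideal_mem[OF J] by auto
  define e where "e = from_nat_into J"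
  have e: "range e = J"
    unfolding e_def using po_ideal_nonempty[OF J] countable_subset[OF sub countable_P]
    by (rule range_from_nat_into)
  \<comment> \<open>a state of the construction: a trim subset of \<open>A\<close> and its label, which lies in \<open>J\<close>\<close>
  define ok where "ok s \<longleftrightarrow> p_trim W \<Y> (snd s) (fst s) \<and> fst s \<subseteq> A \<and> snd s \<in> J" for s
  \<comment> \<open>each step climbs above one element of \<open>J\<close> and decides one compact open set\<close>
  define nxt :: "nat \<Rightarrow> 'w set \<times> 'p \<Rightarrow> 'w set \<times> 'p \<Rightarrow> bool" where "nxt n s t \<longleftrightarrow> fst t \<subseteq> fst s \<and> po_le P (e n) (snd t) \<and>
      (fst t \<subseteq> enum n \<or> fst t \<inter> enum n = {})" for n s t
  have step: "\<exists>t. ok t \<and> nxt n s t" if s: "ok s" for s n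
  proof -
    have B: "p_trim W \<Y> (snd s) (fst s)" "fst s \<subseteq> A" "snd s \<in> J"
      using s by (auto simp: ok_def)
    have "e n \<in> J" using e by auto
    then obtain r where r: "r \<in> J" "po_le P (snd s) r" "po_le P (e n) r"
      by (rule po_ideal_directed[OF J B(3)])
    obtain y where y: "y \<in> fst s" "y \<in> block \<Y> r"
      using p_trim_meets[OF B(1) r(2)] .
    define U where "U = (if y \<in> enum n then fst s \<inter> enum n else fst s - enum n)"
    have "enum n \<in> compact_opens W" using range_enum by blast
    then have "openin W U"
      using p_trim_compact_open[OF B(1)]
      by (simp add: U_def compact_opens_openin compact_opens_Int compact_opens_Diff)
    moreover have "y \<in> U" using y by (simp add: U_def)
    ultimately obtain D where D: "p_trim W \<Y> r D" "y \<in> D" "D \<subseteq> U"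
      by (rule p_trim_neighbourhood[OF po_ideal_mem[OF J r(1)] y(2)])
    have "U \<subseteq> fst s" "U \<subseteq> enum n \<or> U \<inter> enum n = {}"
      by (auto simp: U_def)
    then have "ok (D, r)" "nxt n s (D, r)"
      using D B(2) r by (auto simp: ok_def nxt_def)
    then show ?thesis by blast
  qed
  have "ok (A, p)" using A p by (simp add: ok_def)
  then have "\<exists>s. \<forall>n. ok (s n) \<and> nxt n (s n) (s (Suc n))"
    using dependent_nat_choice[of "\<lambda>_. ok" nxt] step by metis
  then obtain s where s: "\<And>n. ok (s n)" "\<And>n. nxt n (s n) (s (Suc n))" by blast
  have tr: "p_trim W \<Y> (snd (s n)) (fst (s n))" and inA: "fst (s n) \<subseteq> A" and inJ: "snd (s n) \<in> J" for n
    using s(1)[of n] by (auto simp: ok_def)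
  obtain w where w: "\<And>n. w \<in> fst (s n)" "\<And>U. openin W U \<Longrightarrow> w \<in> U \<Longrightarrow> \<exists>n. fst (s n) \<subseteq> U"
  proof (rule nested_compact_opens_base[of "\<lambda>n. fst (s n)"])
    show "fst (s n) \<in> compact_opens W" for n
      using tr by (rule p_trim_compact_open)
    show "fst (s n) \<noteq> {}" for n
      using p_trim_meets_own_block[OF tr] by blast
  qed (use s(2) in \<open>auto simp: nxt_def\<close>)
  have wW: "w \<in> topspace W"
    using p_trim_topspace[OF A] w(1)[of 0] inA by blast
  have snI: "snd (s n) \<in> I w" for n
    using tr w(1) mem_I by blast
  have "I w = J"
  proof
    show "I w \<subseteq> J"
    proof
      fix q assume "q \<in> I w"
      then obtain B where B: "p_trim W \<Y> q B" "w \<in> B" using mem_I by blast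
      then obtain n where n: "fst (s n) \<subseteq> B"
        using w(2) p_trim_openin by metis
      obtain c where "c \<in> fst (s n)" "c \<in> block \<Y> (snd (s n))"
        using p_trim_meets_own_block[OF tr] .
      then have "po_le P q (snd (s n))"
        using p_trim_le[OF B(1)] n p_trim_mem[OF tr] by blast
      then show "q \<in> J" by (rule po_ideal_lower[OF J inJ])
    qed
    show "J \<subseteq> I w"
    proof
      fix q assume "q \<in> J"
      then obtain n where "q = e n" using e by auto
      then have "po_le P q (snd (s (Suc n)))" using s(2)[of n] by (simp add: nxt_def)
      then show "q \<in> I w" by (rule po_ideal_lower[OF po_ideal_I[OF wW] snI])
    qed
  qed
  then show ?thesis using w(1) inA by blast
qed

abbreviation completion where "completion \<equiv> ideal_completion W \<Y>"

lemma index_completion: "index completion = id_po P"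
  by (simp add: ideal_completion_def)

lemma block_completion: "w \<in> block completion J \<longleftrightarrow> w \<in> topspace W \<and> I w = J"
  by (simp add: ideal_completion_def)

lemma mem_block_completion: "w \<in> topspace W \<Longrightarrow> w \<in> block completion (I w)"
  by (simp add: block_completion)

lemma lt_id_po: "(K, J) \<in> lt (id_po P) \<longleftrightarrow>
    po_ideal P K \<and> po_ideal P J \<and> (K \<subset> J \<or> K = J \<and> J \<notin> down_set P ` pts_d P)"
  by (auto simp: id_po_def)

text \<open>A trim set around \<open>w\<close> contains a point with \<open>I = J\<close> exactly if its label belongs to \<open>J\<close>; letting
  the trim set vary gives the condition \<open>I\<^sub>w \<subseteq> J\<close>.  In the case \<open>I\<^sub>w = J\<close> that point has to be
  different from \<open>w\<close>.  If \<open>J\<close> is principal, its block is a block of \<open>\<Y>\<close>, which settles the question.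
  Otherwise \<open>J\<close> has a label strictly above that of the given trim neighbourhood; the point is then
  found in a trim subset with that label which misses \<open>w\<close>.\<close>

lemma limit_point_completion:
  assumes w: "w \<in> topspace W" and J: "po_ideal P J"
  shows "w \<in> W derived_set_of block completion J \<longleftrightarrow> (I w, J) \<in> lt (id_po P)"
proof
  assume L: "w \<in> W derived_set_of block completion J"
  have near: "\<exists>y. y \<noteq> w \<and> y \<in> U \<and> I y = J" if "openin W U" "w \<in> U" for U
    using L that unfolding in_derived_set_of block_completion by blast
  have "I w \<subseteq> J"
  proof
    fix p assume "p \<in> I w"
    then obtain A where A: "p_trim W \<Y> p A" "w \<in> A" using mem_I by blast
    then obtain y where "y \<in> A" "I y = J"
      using near p_trim_openin by metis
    then show "p \<in> J" using A mem_I by blast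
  qed
  moreover have False if IJ: "I w = J" and d: "J \<in> down_set P ` pts_d P"
  proof -
    obtain p where p: "p \<in> pts_d P" "J = down_set P p" using d by blast
    then have pP: "p \<in> pts P" by (simp add: pts_d_def)
    have wp: "w \<in> block \<Y> p" using block_iff_I[OF pP w] IJ p(2) by simp
    then obtain A where A: "p_trim W \<Y> p A" "w \<in> A"
      using p_trim_neighbourhood[OF pP _ openin_topspace w] by blast
    then obtain y where y: "y \<noteq> w" "y \<in> A" "I y = J"
      using near p_trim_openin by metis
    have "y \<in> topspace W"
      using p_trim_topspace[OF A(1)] y(2) .
    then have "y \<in> block \<Y> p" using block_iff_I[OF pP] y(3) p(2) by simp
    moreover have "card (A \<inter> block \<Y> p) = 1" using A(1) p(1) by (simp add: p_trim_def)
    then obtain a where "A \<inter> block \<Y> p = {a}" by (auto simp: card_1_singleton_iff)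
    ultimately show False using wp y A(2) by (metis IntI singletonD)
  qed
  ultimately show "(I w, J) \<in> lt (id_po P)"
    using po_ideal_I[OF w] J by (auto simp: lt_id_po)
next
  assume lt: "(I w, J) \<in> lt (id_po P)"
  then have sub: "I w \<subseteq> J" by (auto simp: lt_id_po)
  show "w \<in> W derived_set_of block completion J"
    unfolding in_derived_set_of
  proof (intro conjI allI impI w)
    fix U assume U: "w \<in> U \<and> openin W U"
    then obtain p A where A: "p_trim W \<Y> p A" "w \<in> A" "A \<subseteq> U"
      using trim_neighbourhood by blast
    have pI: "p \<in> I w" using A mem_I by blast
    have pJ: "p \<in> J" using sub pI by blast
    have pP: "p \<in> pts P" by (rule p_trim_mem[OF A(1)])
    consider (neq) "I w \<noteq> J" | (nonprincipal) "I w = J" "\<And>r. r \<in> pts P \<Longrightarrow> J \<noteq> down_set P r"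
      | (principal) r where "I w = J" "r \<in> pts P" "J = down_set P r" "r \<notin> pts_d P"
      using lt unfolding lt_id_po by blast
    then show "\<exists>y. y \<noteq> w \<and> y \<in> block completion J \<and> y \<in> U"
    proof cases
      case neq
      obtain y where y: "y \<in> A" "I y = J" using ideal_realized[OF J pJ A(1)] by blast
      moreover have "y \<in> topspace W"
        using p_trim_topspace[OF A(1) y(1)] .
      ultimately show ?thesis using neq A(3) by (auto simp: block_completion)
    next
      case nonprincipal
      then obtain q where "q \<in> J" "q \<notin> down_set P p"
        using down_set_subset_ideal[OF J pJ] pP by blast
      obtain r where r: "r \<in> J" "po_le P p r" "po_le P q r"
        by (rule po_ideal_directed[OF J pJ \<open>q \<in> J\<close>])
      have rP: "r \<in> pts P" by (rule po_ideal_mem[OF J r(1)])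
      obtain y where y: "y \<in> A" "y \<in> block \<Y> r" using p_trim_meets[OF A(1) r(2)] .
      have "y \<noteq> w" using I_block[OF rP y(2)] nonprincipal rP by auto
      then obtain B where B: "B \<in> compact_opens W" "y \<in> B" "B \<subseteq> A" "w \<notin> B"
        using ex_compact_open_avoiding[OF p_trim_openin[OF A(1)] y(1) w]
        by metis
      obtain C where C: "p_trim W \<Y> r C" "y \<in> C" "C \<subseteq> B"
        using p_trim_neighbourhood[OF rP y(2) compact_opens_openin[OF B(1)] B(2)] .
      obtain z where z: "z \<in> C" "I z = J" using ideal_realized[OF J r(1) C(1)] by blast
      moreover have "z \<in> topspace W"
        using p_trim_topspace[OF C(1) z(1)] .
      moreover have "z \<noteq> w" "z \<in> U" using z(1) C(3) B(3,4) A(3) by auto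
      ultimately show ?thesis by (auto simp: block_completion)
    next
      case principal
      have wr: "w \<in> block \<Y> r" using block_iff_I[OF principal(2) w] principal by simp
      have "(r, r) \<in> lt P" using principal(2,4) by (simp add: pts_d_def)
      then have "w \<in> W derived_set_of block \<Y> r"
        using lt_iff_limit_point[OF part wr principal(2,2)] by simp
      then obtain z where z: "z \<noteq> w" "z \<in> block \<Y> r" "z \<in> U"
        using U unfolding in_derived_set_of by blast
      then have "z \<in> topspace W" using block_topspace[OF part principal(2)] by blast
      then show ?thesis using z I_block[OF principal(2) z(2)] principal by (auto simp: block_completion)
    qed
  qed
qed


lemma complete_completion: "support completion = topspace W"
proof
  show "topspace W \<subseteq> support completion"
    using po_ideal_I mem_block_completion
    by (auto simp: support_def index_completion pts_id_po)
qed (auto simp: support_def block_completion)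

lemma partition_completion: "P_partition W completion"
  unfolding P_partition_def index_completion
proof (intro conjI ballI)
  show "is_po_system (id_po P)" by (rule is_po_system_id_po)
  show "disjoint_family_on (block completion) (pts (id_po P))"
    by (auto simp: disjoint_family_on_def block_completion)
  fix J assume "J \<in> pts (id_po P)"
  then have J: "po_ideal P J" by (simp add: pts_id_po)
  obtain p where p: "p \<in> J" using po_ideal_nonempty[OF J] by blast
  obtain A where A: "p_trim W \<Y> p A" using ex_p_trim[OF po_ideal_mem[OF J p]] .
  obtain w where w: "w \<in> A" "I w = J" using ideal_realized[OF J p A] by blast
  have "w \<in> block completion J"
    using p_trim_topspace[OF A w(1)] w(2) by (simp add: block_completion)
  then show "block completion J \<noteq> {}" by blast
  show "block completion J \<subseteq> topspace W" by (auto simp: block_completion)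
  have "W derived_set_of block completion J =
      {w \<in> topspace W. w \<in> W derived_set_of block completion J}"
    using derived_set_of_subset_topspace[of W "block completion J"] by auto
  also have "\<dots> = {w \<in> topspace W. (I w, J) \<in> lt (id_po P)}"
    using limit_point_completion[OF _ J] by auto
  also have "\<dots> = (\<Union>K\<in>{K \<in> pts (id_po P). (K, J) \<in> lt (id_po P)}. block completion K)"
    by (auto simp: block_completion pts_id_po lt_id_po)
  finally show "(W derived_set_of block completion J) \<inter> support completion =
      (\<Union>K\<in>{K \<in> pts (id_po P). (K, J) \<in> lt (id_po P)}. block completion K)"
    unfolding complete_completion using derived_set_of_subset_topspace[of W] by blast
qed

lemma label_completion: "w \<in> topspace W \<Longrightarrow> label completion w = I w"
  using label_eqI[OF partition_completion mem_block_completion] po_ideal_I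
  by (simp add: index_completion pts_id_po)

text \<open>The separated ideals are the principal ones.  Since \<open>p \<in> I\<^sub>x\<close> is witnessed by a
  neighbourhood of \<open>x\<close>, the first axiom of rank partitions holds for every convergent sequence;
  and if \<open>I\<^sub>x\<close> is not principal, the points with principal label in a trim neighbourhood of \<open>x\<close>
  yield the sequence required by the second axiom.\<close>

lemma rank_completion: "rank_partition W completion"
  unfolding rank_partition_def complete_family_def index_completion
proof (intro conjI allI ballI impI partition_completion complete_completion)
  fix J x and xs :: "nat \<Rightarrow> 'w"
  assume "po_separated (id_po P) J \<and> range xs \<subseteq> topspace W \<and> limitin W xs x sequentially \<and>
      po_le (id_po P) J (label completion x) \<and>
      ((\<forall>j k. j \<noteq> k \<longrightarrow> \<not> po_le (id_po P) (label completion (xs j)) (label completion (xs k))) \<or>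
       (\<forall>k. po_less (id_po P) (label completion (xs k)) (label completion (xs (Suc k)))))"
  then have sep: "po_separated (id_po P) J" and xs: "\<And>k. xs k \<in> topspace W"
    and lim: "limitin W xs x sequentially" and le: "po_le (id_po P) J (label completion x)"
    by auto
  have x: "x \<in> topspace W" using lim by (rule limitin_topspace)
  have J: "po_ideal P J" "J \<subseteq> I x"
    using le by (simp_all add: po_le_id_po label_completion[OF x])
  have "J \<subseteq> pts P" using po_ideal_mem[OF J(1)] by auto
  then have "countable J" using countable_P countable_subset by blast
  then obtain p where p: "p \<in> pts P" "J = down_set P p"
    using separated_ideal_principal[OF P_po sep] by blast
  then have "p \<in> I x" using J(2) po_le_refl[OF p(1)] by (auto simp: down_set_iff)
  then obtain A where A: "p_trim W \<Y> p A" "x \<in> A" using mem_I by blast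
  have "\<forall>\<^sub>F k in sequentially. xs k \<in> A"
    using lim A(2) p_trim_openin[OF A(1)] by (simp add: limitin_def)
  then show "\<forall>\<^sub>F k in sequentially. po_le (id_po P) J (label completion (xs k))"
  proof (rule eventually_mono)
    fix k assume "xs k \<in> A"
    then have "p \<in> I (xs k)" using A mem_I by blast
    then show "po_le (id_po P) J (label completion (xs k))"
      using down_set_subset_ideal[OF po_ideal_I[OF xs]] J(1) p(2) po_ideal_I[OF xs]
      by (simp add: po_le_id_po label_completion[OF xs])
  qed
next
  fix x assume x: "x \<in> topspace W" and "\<not> po_separated (id_po P) (label completion x)"
  then have np: "I x \<noteq> down_set P p" if "p \<in> pts P" for p
    using principal_ideal_separated[OF P_po that] by (auto simp: label_completion[OF x])
  let ?S = "{y \<in> topspace W. I y \<subset> I x}"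
  have "x \<in> W closure_of ?S"
    unfolding in_closure_of
  proof (intro conjI allI impI x)
    fix U assume "x \<in> U \<and> openin W U"
    then obtain p A where A: "p_trim W \<Y> p A" "x \<in> A" "A \<subseteq> U"
      using trim_neighbourhood by blast
    obtain y where y: "y \<in> A" "y \<in> block \<Y> p" using p_trim_meets_own_block[OF A(1)] .
    have pP: "p \<in> pts P" by (rule p_trim_mem[OF A(1)])
    have "p \<in> I x" using A mem_I by blast
    then have "I y \<subset> I x"
      using down_set_subset_ideal[OF po_ideal_I[OF x]] np[OF pP] I_block[OF pP y(2)] by blast
    then show "\<exists>y. y \<in> ?S \<and> y \<in> U"
      using y(1) A(3) p_trim_topspace[OF A(1) y(1)] by blast
  qed
  then obtain xs :: "nat \<Rightarrow> 'w" where xs: "range xs \<subseteq> ?S" "limitin W xs x sequentially"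
    by (rule closure_of_sequence)
  have "po_less (id_po P) (label completion (xs k)) (label completion x)" for k
  proof -
    have "xs k \<in> ?S" using xs(1) by blast
    then show ?thesis
      by (auto simp: po_less_def po_le_id_po label_completion x po_ideal_I)
  qed
  then show "\<exists>xs :: nat \<Rightarrow> 'w. range xs \<subseteq> topspace W \<and> limitin W xs x sequentially \<and>
      (\<forall>k. po_less (id_po P) (label completion (xs k)) (label completion x))"
    using xs by (intro exI[of _ xs]) auto
qed

text \<open>Around a point with \<open>I\<^sub>w = J\<close> the set contains a trim set of \<open>\<Y>\<close>, whose label \<open>p\<close> belongs to \<open>J\<close>.
  Its points in the block of \<open>p\<close> have as label in the completion the ideal generated by \<open>p\<close>, which must
  contain \<open>J\<close>, because \<open>J\<close> is the least label in the given set.\<close>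

lemma p_trim_completion_principal:
  assumes A: "p_trim W completion J A"
  obtains p where "p \<in> pts P" "J = down_set P p"
proof -
  obtain w where w: "w \<in> A" "w \<in> block completion J" using p_trim_meets_own_block[OF A] .
  obtain p C where C: "p_trim W \<Y> p C" "w \<in> C" "C \<subseteq> A"
    using trim_neighbourhood[OF p_trim_openin[OF A] w(1)] .
  have pP: "p \<in> pts P" by (rule p_trim_mem[OF C(1)])
  obtain y where y: "y \<in> C" "y \<in> block \<Y> p" using p_trim_meets_own_block[OF C(1)] .
  have yA: "y \<in> A" using y(1) C(3) by blast
  have yW: "y \<in> topspace W" by (rule p_trim_topspace[OF A yA])
  have "po_le (id_po P) J (I y)"
    using p_trim_le[OF A yA mem_block_completion[OF yW]] po_ideal_I[OF yW]
    by (simp add: index_completion pts_id_po)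
  then have "po_ideal P J" "J \<subseteq> down_set P p"
    using I_block[OF pP y(2)] by (simp_all add: po_le_id_po)
  moreover have "p \<in> J" using C w(2) mem_I by (auto simp: block_completion)
  ultimately have "J = down_set P p"
    using down_set_subset_ideal[of P J p] by auto
  then show thesis by (rule that[OF pP])
qed

lemma pts_d_id_po: "p \<in> pts P \<Longrightarrow> down_set P p \<in> pts_d (id_po P) \<longleftrightarrow> p \<in> pts_d P"
  using down_set_eq_iff[OF P_po] po_ideal_down_set[OF P_po]
  by (auto simp: pts_d_def id_po_def)

text \<open>An ideal is the label in the completion of some point of a \<open>p\<close>-trim set of \<open>\<Y>\<close> exactly if it
  contains \<open>p\<close>, by \<open>ideal_realized\<close>.  Conversely, the labels of \<open>\<Y>\<close> are recovered from the
  principal ideals among the labels of the completion.\<close>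

lemma p_trim_completion_iff:
  assumes p: "p \<in> pts P"
  shows "p_trim W completion (down_set P p) A \<longleftrightarrow> p_trim W \<Y> p A"
proof -
  have iP: "po_ideal P (down_set P p)" by (rule po_ideal_down_set[OF P_po p])
  have blk: "A \<inter> block completion (down_set P q) = A \<inter> block \<Y> q"
    if "A \<in> compact_opens W" "q \<in> pts P" for q
    using block_iff_I[OF that(2)] compact_opens_topspace[OF that(1)] by (auto simp: block_completion)
  have up: "J \<in> up_set (id_po P) (down_set P p) \<longleftrightarrow> po_ideal P J \<and> p \<in> J" for J
    using iP down_set_subset_ideal[of P J p] po_le_refl[OF p]
    by (auto simp: up_set_iff po_le_id_po down_set_iff subset_iff)
  show ?thesis
  proof
    assume A: "p_trim W completion (down_set P p) A"
    have cA: "A \<in> compact_opens W" by (rule p_trim_compact_open[OF A])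
    have "A \<inter> block \<Y> q \<noteq> {} \<longleftrightarrow> po_le P p q" if q: "q \<in> pts P" for q
    proof -
      have "A \<inter> block completion (down_set P q) \<noteq> {} \<longleftrightarrow>
          po_le (id_po P) (down_set P p) (down_set P q)"
        using p_trim_iff_le[OF A] po_ideal_down_set[OF P_po q]
        by (simp add: index_completion pts_id_po)
      then show ?thesis
        using blk[OF cA q] iP po_ideal_down_set[OF P_po q] down_set_subset_iff[OF P_po p]
        by (simp add: po_le_id_po)
    qed
    then have "{q \<in> pts P. A \<inter> block \<Y> q \<noteq> {}} = up_set P p"
      by (auto simp: up_set_def)
    moreover have "card (A \<inter> block \<Y> p) = 1" if "p \<in> pts_d P"
      using A blk[OF cA p] that unfolding p_trim_def index_completion pts_d_id_po[OF p] by simp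
    ultimately show "p_trim W \<Y> p A"
      using p cA by (simp add: p_trim_def)
  next
    assume A: "p_trim W \<Y> p A"
    have cA: "A \<in> compact_opens W" by (rule p_trim_compact_open[OF A])
    have "A \<inter> block completion J \<noteq> {} \<longleftrightarrow> p \<in> J" if J: "po_ideal P J" for J
    proof
      assume "A \<inter> block completion J \<noteq> {}"
      then show "p \<in> J" using A mem_I by (auto simp: block_completion)
    next
      assume "p \<in> J"
      then obtain w where "w \<in> A" "I w = J" using ideal_realized[OF J _ A] by blast
      then show "A \<inter> block completion J \<noteq> {}"
        using p_trim_topspace[OF A] by (auto simp: block_completion)
    qed
    then have "{J \<in> pts (id_po P). A \<inter> block completion J \<noteq> {}} = up_set (id_po P) (down_set P p)"
      by (intro set_eqI) (simp add: pts_id_po up cong: conj_cong)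
    moreover have "card (A \<inter> block completion (down_set P p)) = 1" if "p \<in> pts_d P"
      using A blk[OF cA p] that by (simp add: p_trim_def)
    ultimately show "p_trim W completion (down_set P p) A"
      using iP cA unfolding p_trim_def index_completion pts_d_id_po[OF p] by (simp add: pts_id_po)
  qed
qed

lemma P_hat_completion: "P_hat W completion = down_set P ` pts P"
proof
  show "P_hat W completion \<subseteq> down_set P ` pts P"
    unfolding P_hat_def using p_trim_completion_principal by blast
  show "down_set P ` pts P \<subseteq> P_hat W completion"
  proof
    fix J assume "J \<in> down_set P ` pts P"
    then obtain p where p: "p \<in> pts P" "J = down_set P p" by blast
    obtain A where "p_trim W \<Y> p A" using ex_p_trim[OF p(1)] .
    then have "p_trim W completion J A" using p_trim_completion_iff[OF p(1)] p(2) by simp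
    then show "J \<in> P_hat W completion"
      using p_trim_mem[of W completion J A] by (auto simp: P_hat_def)
  qed
qed

text \<open>The clean interior of the completion discards exactly the non-principal ideals, and the block of
  the ideal generated by \<open>p\<close> is the block of \<open>p\<close>.\<close>

theorem relabels_clean_interior_completion:
  "relabels_via (down_set P) \<Y> (clean_interior W completion)"
proof -
  have lt: "(down_set P p, down_set P q) \<in> lt (id_po P) \<longleftrightarrow> (p, q) \<in> lt P"
    if "p \<in> pts P" "q \<in> pts P" for p q
  proof (cases "p = q")
    case True
    then show ?thesis using pts_d_id_po[OF that(1)] that po_ideal_down_set[OF P_po that(1)]
      by (simp add: pts_d_def pts_id_po)
  next
    case False
    then have "(down_set P p, down_set P q) \<in> lt (id_po P) \<longleftrightarrow> po_le P p q"
      using down_set_subset_iff[OF P_po that(1), of q] down_set_eq_iff[OF P_po that]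
        po_ideal_down_set[OF P_po that(1)] po_ideal_down_set[OF P_po that(2)]
      by (auto simp: lt_id_po)
    then show ?thesis using False that by (simp add: po_le_def)
  qed
  have "{w \<in> block completion (down_set P p). clean_point W completion w} = block \<Y> p"
    if p: "p \<in> pts P" for p
  proof -
    have "w \<in> block completion (down_set P p) \<longleftrightarrow> w \<in> block \<Y> p" for w
      using block_iff_I[OF p] block_topspace[OF part p] by (auto simp: block_completion)
    moreover have "clean_point W completion w" if w: "w \<in> block \<Y> p" for w
    proof -
      have wW: "w \<in> topspace W" using block_topspace[OF part p] w by blast
      obtain A where "p_trim W \<Y> p A" "w \<in> A"
        using p_trim_neighbourhood[OF p w openin_topspace wW] .
      then have A: "p_trim W completion (down_set P p) A" "w \<in> A"
        using p_trim_completion_iff[OF p] by simp_all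
      moreover have "w \<in> block completion (down_set P p)"
        using mem_block_completion[OF wW] I_block[OF p w] by simp
      ultimately show ?thesis
        unfolding clean_point_def using p_trim_mem[OF A(1)] by metis
    qed
    ultimately show ?thesis by auto
  qed
  moreover have "inj_on (down_set P) (pts P)"
    using down_set_eq_iff[OF P_po] by (simp add: inj_on_def)
  moreover have "is_po_system (index (clean_interior W completion))"
    using is_po_system_restrict[OF is_po_system_id_po]
    by (simp add: clean_interior_def index_completion)
  ultimately show ?thesis
    using P_po lt by (simp add: relabels_via_def clean_interior_def P_hat_completion
        index_completion bij_betw_def)
qed

end


section \<open>The clean interior of a rank partition\<close>

text \<open>The colour of a pair of indices records how \<open>R\<close> compares the terms.  Weakly decreasing pairs share
  one colour, also when the terms are equal, so that three kinds of subsequences remain.\<close>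

lemma ramsey_subsequence:
  fixes t :: "nat \<Rightarrow> 'p"
  obtains r :: "nat \<Rightarrow> nat" where "strict_mono r" "\<And>i j. i < j \<Longrightarrow> R (t (r j)) (t (r i))"
  | r :: "nat \<Rightarrow> nat" where "strict_mono r"
      "\<And>i j. i < j \<Longrightarrow> R (t (r i)) (t (r j)) \<and> \<not> R (t (r j)) (t (r i))"
  | r :: "nat \<Rightarrow> nat" where "strict_mono r"
      "\<And>i j. i < j \<Longrightarrow> \<not> R (t (r i)) (t (r j)) \<and> \<not> R (t (r j)) (t (r i))"
proof -
  define c :: "nat set \<Rightarrow> nat" where "c X = (if R (t (Max X)) (t (Min X)) then 0 else
    if R (t (Min X)) (t (Max X)) then 1 else 2)" for X
  have "\<forall>x\<in>UNIV. \<forall>y\<in>UNIV. x \<noteq> y \<longrightarrow> c {x, y} < 3" by (simp add: c_def)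
  from Ramsey2[OF infinite_UNIV_nat this] obtain Y k
    where Y: "infinite Y" "\<forall>x\<in>Y. \<forall>y\<in>Y. x \<noteq> y \<longrightarrow> c {x, y} = k"
    by blast
  define r where "r = enumerate Y"
  have r: "strict_mono r" unfolding r_def by (rule strict_mono_enumerate[OF Y(1)])
  have rY: "r i \<in> Y" for i unfolding r_def by (rule enumerate_in_set[OF Y(1)])
  have k: "k = (if R (t (r j)) (t (r i)) then 0 else if R (t (r i)) (t (r j)) then 1 else 2)"
    if "i < j" for i j
  proof -
    have lt: "r i < r j" using strict_monoD[OF r that] .
    then have "k = c {r i, r j}" using Y(2) rY by (metis less_irrefl)
    also have "\<dots> = (if R (t (r j)) (t (r i)) then 0 else if R (t (r i)) (t (r j)) then 1 else 2)"
      using lt by (simp add: c_def min_def max_def)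
    finally show ?thesis .
  qed
  from k[of 0 1] consider "k = 0" | "k = 1" | "k = 2" by (auto split: if_splits)
  then show thesis
  proof cases
    case 1
    then show thesis using k by (intro that(1)[OF r]) (simp split: if_splits)
  next
    case 2
    then show thesis using k by (intro that(2)[OF r]) (simp split: if_splits)
  next
    case 3
    then show thesis using k by (intro that(3)[OF r]) (simp split: if_splits)
  qed
qed

locale rank_partitioned = omega_stone W
  for W :: "'w topology" +
  fixes \<Z> :: "('p, 'w) labelled_family"
  assumes rank: "rank_partition W \<Z>"
begin

abbreviation P where "P \<equiv> index \<Z>"
abbreviation \<tau> where "\<tau> \<equiv> label \<Z>"

lemma part: "P_partition W \<Z>"
  using rank by (simp add: rank_partition_def)

lemmas P_po = partition_po[OF part]

lemma label_block: "w \<in> topspace W \<Longrightarrow> \<tau> w \<in> pts P \<and> w \<in> block \<Z> (\<tau> w)"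
proof -
  assume "w \<in> topspace W"
  then have "w \<in> support \<Z>" using rank by (simp add: rank_partition_def complete_family_def)
  then obtain p where "p \<in> pts P" "w \<in> block \<Z> p" by (auto simp: support_def)
  then show ?thesis using label_eqI[OF part] by simp
qed

lemmas label_mem = label_block[THEN conjunct1] and label_in_block = label_block[THEN conjunct2]

lemma label_le_iff_closure:
  assumes "w \<in> topspace W" "p \<in> pts P"
  shows "po_le P (\<tau> w) p \<longleftrightarrow> w \<in> W closure_of block \<Z> p"
  using le_iff_closure[OF part label_in_block label_mem] assms by blast

text \<open>If points \<open>x\<^sub>k\<close> with labels not above \<open>q\<close> converged to a point with label above \<open>q\<close>, Ramsey's
  theorem would give a subsequence of one of three kinds.  Incomparable or strictly increasing
  labels are ruled out by the first axiom; weakly decreasing labels keep the sequence in the block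
  closure of the first term, whose label is then above \<open>q\<close>.\<close>

lemma openin_labels_above_separated:
  assumes q: "po_separated P q"
  shows "openin W {x \<in> topspace W. po_le P q (\<tau> x)}"
proof -
  let ?S = "{x \<in> topspace W. \<not> po_le P q (\<tau> x)}"
  have "W closure_of ?S \<subseteq> ?S"
  proof
    fix x assume xS: "x \<in> W closure_of ?S"
    then have x: "x \<in> topspace W" by (simp add: in_closure_of)
    have False if qx: "po_le P q (\<tau> x)"
    proof -
      obtain xs :: "nat \<Rightarrow> 'w" where xs: "range xs \<subseteq> ?S" "limitin W xs x sequentially"
        using closure_of_sequence[OF xS] .
      have lim: "limitin W (xs \<circ> r) x sequentially" if "strict_mono r" for r
        using limitin_subsequence[OF that xs(2)] .
      have S: "xs n \<in> topspace W" "\<not> po_le P q (\<tau> (xs n))" for n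
        using xs(1) by auto
      have no: False if r: "strict_mono r" and
        H: "(\<forall>j k. j \<noteq> k \<longrightarrow> \<not> po_le P (\<tau> ((xs \<circ> r) j)) (\<tau> ((xs \<circ> r) k))) \<or>
            (\<forall>k. po_less P (\<tau> ((xs \<circ> r) k)) (\<tau> ((xs \<circ> r) (Suc k))))" for r
      proof -
        have "range (xs \<circ> r) \<subseteq> topspace W" using S(1) by auto
        then have "\<forall>\<^sub>F k in sequentially. po_le P q (\<tau> ((xs \<circ> r) k))"
          using rank q lim[OF r] qx H unfolding rank_partition_def by blast
        then show False using S(2) by simp
      qed
      show False
      proof (rule ramsey_subsequence[of "po_le P" "\<tau> \<circ> xs"])
        fix r :: "nat \<Rightarrow> nat"
        assume r: "strict_mono r"
          and le: "\<And>i j. i < j \<Longrightarrow> po_le P ((\<tau> \<circ> xs) (r j)) ((\<tau> \<circ> xs) (r i))"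
        let ?p = "\<tau> (xs (r 0))"
        have pP: "?p \<in> pts P" by (rule label_mem[OF S(1)])
        have in_cl: "xs (r n) \<in> W closure_of block \<Z> ?p" for n
        proof -
          have "po_le P (\<tau> (xs (r n))) ?p"
            using le[of 0 n] po_le_refl[OF pP] by (cases "n = 0") simp_all
          then show ?thesis using label_le_iff_closure[OF S(1) pP] by simp
        qed
        have "x \<in> W closure_of block \<Z> ?p"
          by (rule limitin_closedin[OF lim[OF r]]) (simp_all add: in_cl)
        then have "po_le P (\<tau> x) ?p" using label_le_iff_closure[OF x pP] by simp
        then show False using po_le_trans[OF P_po qx] S(2) by blast
      next
        fix r :: "nat \<Rightarrow> nat"
        assume r: "strict_mono r" and lt: "\<And>i j. i < j \<Longrightarrow>
          po_le P ((\<tau> \<circ> xs) (r i)) ((\<tau> \<circ> xs) (r j)) \<and> \<not> po_le P ((\<tau> \<circ> xs) (r j)) ((\<tau> \<circ> xs) (r i))"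
        have "po_less P (\<tau> ((xs \<circ> r) k)) (\<tau> ((xs \<circ> r) (Suc k)))" for k
          using lt[of k "Suc k"] by (auto simp: po_less_def)
        then show False using no[OF r] by blast
      next
        fix r :: "nat \<Rightarrow> nat"
        assume r: "strict_mono r" and inc: "\<And>i j. i < j \<Longrightarrow>
          \<not> po_le P ((\<tau> \<circ> xs) (r i)) ((\<tau> \<circ> xs) (r j)) \<and> \<not> po_le P ((\<tau> \<circ> xs) (r j)) ((\<tau> \<circ> xs) (r i))"
        have "\<not> po_le P (\<tau> ((xs \<circ> r) j)) (\<tau> ((xs \<circ> r) k))" if "j \<noteq> k" for j k
          using inc[of j k] inc[of k j] that by (cases "j < k") auto
        then show False using no[OF r] by blast
      qed
    qed
    then show "x \<in> ?S" using x by blast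
  qed
  then have "closedin W ?S"
    using closure_of_subset_eq[of ?S W] by auto
  then have "openin W (topspace W - ?S)"
    by (rule openin_diff[OF openin_topspace])
  moreover have "topspace W - ?S = {x \<in> topspace W. po_le P q (\<tau> x)}" by auto
  ultimately show ?thesis by simp
qed

text \<open>By compactness the labels that are at most \<open>\<tau> w\<close> and occur in a compact open \<open>K\<close> have a minimal
  element: a chain of labels gives a chain of block closures which all meet \<open>K\<close>, and the label of a
  common point bounds the chain from below.  The second axiom makes a minimal label separated.\<close>

lemma ex_separated_label_below:
  assumes K: "K \<in> compact_opens W" and w: "w \<in> K"
  obtains x where "x \<in> K" "po_separated P (\<tau> x)" "po_le P (\<tau> x) (\<tau> w)"
proof -
  let ?A = "{\<tau> x |x. x \<in> K \<and> po_le P (\<tau> x) (\<tau> w)}"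
  let ?ge = "\<lambda>p q. po_le P q p"
  have KW: "x \<in> topspace W" if "x \<in> K" for x using compact_opens_topspace[OF K that] .
  have A: "p \<in> pts P" if "p \<in> ?A" for p using that label_mem[OF KW] by auto
  have tw: "\<tau> w \<in> ?A" using w po_le_refl[OF label_mem[OF KW[OF w]]] by blast
  have "\<exists>m\<in>?A. \<forall>a\<in>?A. ?ge m a \<longrightarrow> a = m"
  proof (rule predicate_Zorn)
    show "partial_order_on ?A (relation_of ?ge ?A)"
    proof (rule partial_order_on_relation_ofI)
      show "?ge a a" if "a \<in> ?A" for a using po_le_refl[OF A[OF that]] .
      show "?ge a c" if "?ge a b" "?ge b c" for a b c using po_le_trans[OF P_po that(2,1)] .
      show "a = b" if "?ge a b" "?ge b a" for a b using po_le_antisym[OF P_po that(2,1)] .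
    qed
    fix C assume C: "C \<in> Chains (relation_of ?ge ?A)"
    then have CA: "C \<subseteq> ?A" by (rule Chains_relation_of)
    have tot: "po_le P p q \<or> po_le P q p" if "p \<in> C" "q \<in> C" for p q
      using C that by (auto simp: Chains_def relation_of_def)
    show "\<exists>u\<in>?A. \<forall>a\<in>C. ?ge a u"
    proof (cases "C = {}")
      case True
      then show ?thesis using tw by blast
    next
      case False
      let ?cl = "\<lambda>p. W closure_of block \<Z> p"
      have "K \<inter> \<Inter>(?cl ` C) \<noteq> {}"
      proof (rule compactin_Int_chain_nonempty)
        show "compactin W K" "K \<noteq> {}" using K w by (auto simp: compact_opens_def)
        show "closedin W D \<and> K \<inter> D \<noteq> {}" if "D \<in> ?cl ` C" for D
        proof -
          obtain p where p: "p \<in> C" "D = ?cl p" using \<open>D \<in> ?cl ` C\<close> by blast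
          then obtain x where x: "x \<in> K" "p = \<tau> x" using CA by blast
          then have "x \<in> D"
            using label_le_iff_closure[OF KW[OF x(1)] label_mem[OF KW[OF x(1)]]]
              po_le_refl[OF label_mem[OF KW[OF x(1)]]] p(2) by simp
          then show ?thesis using x(1) p(2) by auto
        qed
        have mono: "?cl p \<subseteq> ?cl q" if pq: "po_le P p q" for p q
        proof (rule closure_of_minimal)
          show "block \<Z> p \<subseteq> ?cl q"
            using le_iff_closure[OF part _ po_le_mem(1)[OF pq] po_le_mem(2)[OF pq]] pq by blast
        qed simp
        show "D \<subseteq> E \<or> E \<subseteq> D" if "D \<in> ?cl ` C" "E \<in> ?cl ` C" for D E
        proof -
          obtain p q where "p \<in> C" "D = ?cl p" "q \<in> C" "E = ?cl q"
            using \<open>D \<in> ?cl ` C\<close> \<open>E \<in> ?cl ` C\<close> by blast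
          then show ?thesis using tot[of p q] mono by blast
        qed
      qed
      then obtain x where x: "x \<in> K" "\<And>p. p \<in> C \<Longrightarrow> x \<in> ?cl p" by blast
      then have le: "po_le P (\<tau> x) p" if "p \<in> C" for p
        using label_le_iff_closure[OF KW[OF x(1)] A] that CA by blast
      obtain p where p: "p \<in> C" using False by blast
      then have "po_le P p (\<tau> w)" using CA by blast
      then have "po_le P (\<tau> x) (\<tau> w)" using po_le_trans[OF P_po le[OF p]] by blast
      then have "\<tau> x \<in> ?A" using x(1) by blast
      then show ?thesis using le by (intro bexI[of _ "\<tau> x"]) auto
    qed
  qed
  then obtain x where x: "x \<in> K" "po_le P (\<tau> x) (\<tau> w)"
    and least: "\<And>a. a \<in> ?A \<Longrightarrow> po_le P a (\<tau> x) \<Longrightarrow> a = \<tau> x"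
    by auto
  have "po_separated P (\<tau> x)"
  proof (rule ccontr)
    assume "\<not> ?thesis"
    then obtain xs :: "nat \<Rightarrow> 'w" where xs: "limitin W xs x sequentially"
      "\<And>k. po_less P (\<tau> (xs k)) (\<tau> x)"
      using rank KW[OF x(1)] unfolding rank_partition_def by metis
    have "\<forall>\<^sub>F k in sequentially. xs k \<in> K"
      using xs(1) x(1) compact_opens_openin[OF K] by (simp add: limitin_def)
    then obtain k where k: "xs k \<in> K" by (auto simp: eventually_sequentially)
    have less: "po_le P (\<tau> (xs k)) (\<tau> x)" "\<tau> (xs k) \<noteq> \<tau> x" using xs(2) by (auto simp: po_less_def)
    have "\<tau> (xs k) \<in> ?A" using k po_le_trans[OF P_po less(1) x(2)] by blast
    then show False using least less by blast
  qed
  then show thesis using that x by blast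
qed

text \<open>The point \<open>w\<close> is a limit of points with separated labels below \<open>\<tau> w\<close>.  If these labels are below
  \<open>p\<close>, such points, and hence \<open>w\<close>, lie in the closure of the block of \<open>p\<close>.  In consequence, a label is
  determined by the separated labels below it.\<close>

lemma label_le_if_separated_le:
  assumes w: "w \<in> topspace W" and p: "p \<in> pts P"
    and sep: "\<And>q. po_separated P q \<Longrightarrow> po_le P q (\<tau> w) \<Longrightarrow> po_le P q p"
  shows "po_le P (\<tau> w) p"
  unfolding label_le_iff_closure[OF w p] in_closure_of
proof (intro conjI allI impI w)
  fix U assume "w \<in> U \<and> openin W U"
  then obtain K where K: "K \<in> compact_opens W" "w \<in> K" "K \<subseteq> U"
    using ex_compact_open by metis
  obtain x where x: "x \<in> K" "po_separated P (\<tau> x)" "po_le P (\<tau> x) (\<tau> w)"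
    using ex_separated_label_below[OF K(1,2)] .
  have "x \<in> W closure_of block \<Z> p"
    using sep[OF x(2,3)] label_le_iff_closure[OF compact_opens_topspace[OF K(1) x(1)] p] by simp
  then show "\<exists>y. y \<in> block \<Z> p \<and> y \<in> U"
    using x(1) K(3) compact_opens_openin[OF K(1)] unfolding in_closure_of by blast
qed

text \<open>Let \<open>q = \<tau> w\<close> be separated.  A compact open neighbourhood of \<open>w\<close> on which all labels are above \<open>q\<close> is
  \<open>q\<close>-trim, provided that in case \<open>q \<in> P\<^sup>d\<close>, when the block of \<open>q\<close> is discrete, \<open>w\<close> is its only
  point in that block.\<close>

lemma separated_p_trim_neighbourhood:
  assumes w: "openin W U" "w \<in> U" and sep: "po_separated P (\<tau> w)"
  obtains A where "p_trim W \<Z> (\<tau> w) A" "w \<in> A" "A \<subseteq> U"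
proof -
  have wW: "w \<in> topspace W" using w openin_subset by blast
  let ?q = "\<tau> w" and ?V = "{x \<in> topspace W. po_le P (\<tau> w) (\<tau> x)}"
  have q: "?q \<in> pts P" "w \<in> block \<Z> ?q" using label_mem[OF wW] label_in_block[OF wW] .
  obtain N where N: "openin W N" "w \<in> N" "?q \<in> pts_d P \<Longrightarrow> N \<inter> block \<Z> ?q = {w}"
  proof (cases "?q \<in> pts_d P")
    case True
    then have "w \<notin> W derived_set_of block \<Z> ?q"
      using lt_iff_limit_point[OF part q(2,1,1)] by (simp add: pts_d_def)
    then obtain N where "openin W N" "w \<in> N" "\<And>y. y \<noteq> w \<Longrightarrow> y \<in> block \<Z> ?q \<Longrightarrow> y \<notin> N"
      using wW unfolding in_derived_set_of by blast
    then show thesis using that[of N] q(2) by blast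
  qed (use that[OF openin_topspace wW] in simp)
  have "openin W (U \<inter> N \<inter> ?V)"
    using w(1) N(1) openin_labels_above_separated[OF sep] by (simp add: openin_Int)
  moreover have "w \<in> U \<inter> N \<inter> ?V" using w(2) N(2) wW po_le_refl[OF q(1)] by simp
  ultimately obtain A where A: "A \<in> compact_opens W" "w \<in> A" "A \<subseteq> U \<inter> N \<inter> ?V"
    by (rule ex_compact_open)
  have "A \<inter> block \<Z> r \<noteq> {} \<longleftrightarrow> po_le P ?q r" if r: "r \<in> pts P" for r
  proof
    assume "A \<inter> block \<Z> r \<noteq> {}"
    then obtain y where "y \<in> A" "y \<in> block \<Z> r" by blast
    then show "po_le P ?q r" using A(3) label_eqI[OF part _ r] by blast
  next
    assume "po_le P ?q r"
    then have "w \<in> W closure_of block \<Z> r" using label_le_iff_closure[OF wW r] by simp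
    then show "A \<inter> block \<Z> r \<noteq> {}"
      using A(2) compact_opens_openin[OF A(1)] unfolding in_closure_of by blast
  qed
  then have "{r \<in> pts P. A \<inter> block \<Z> r \<noteq> {}} = up_set P ?q"
    by (auto simp: up_set_def)
  moreover have "card (A \<inter> block \<Z> ?q) = 1" if "?q \<in> pts_d P"
  proof -
    have "A \<inter> block \<Z> ?q = {w}" using N(3)[OF that] A(2,3) q(2) by blast
    then show ?thesis by simp
  qed
  ultimately have "p_trim W \<Z> ?q A" using q(1) A(1) by (simp add: p_trim_def)
  then show thesis using that A by simp
qed

lemma p_trim_separated:
  assumes A: "p_trim W \<Z> q A"
  shows "po_separated P q"
proof -
  obtain x where x: "x \<in> A" "x \<in> block \<Z> q" using p_trim_meets_own_block[OF A] .
  have q: "q \<in> pts P" "q = \<tau> x" using p_trim_mem[OF A] label_eqI[OF part x(2)] by simp_all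
  obtain y where y: "y \<in> A" "po_separated P (\<tau> y)" "po_le P (\<tau> y) q"
    using ex_separated_label_below[OF p_trim_compact_open[OF A] x(1)] unfolding q(2) .
  have yW: "y \<in> topspace W" by (rule p_trim_topspace[OF A y(1)])
  have "po_le P q (\<tau> y)"
    by (rule p_trim_le[OF A y(1) label_in_block[OF yW] label_mem[OF yW]])
  then show ?thesis using po_le_antisym[OF P_po y(3)] y(2) by simp
qed

lemma P_hat_separated: "P_hat W \<Z> = {q. po_separated P q}"
proof (intro set_eqI iffI)
  fix q assume "q \<in> {q. po_separated P q}"
  then have q: "po_separated P q" "q \<in> pts P" by (auto simp: po_separated_def)
  obtain w where w: "w \<in> block \<Z> q" using block_nonempty[OF part q(2)] by blast
  have wW: "w \<in> topspace W" using block_topspace[OF part q(2)] w by blast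
  have "\<tau> w = q" by (rule label_eqI[OF part w q(2)])
  then obtain A where "p_trim W \<Z> q A"
    using separated_p_trim_neighbourhood[OF openin_topspace wW] q(1) by metis
  then show "q \<in> P_hat W \<Z>" using q(2) by (auto simp: P_hat_def)
qed (use p_trim_separated in \<open>auto simp: P_hat_def\<close>)

lemma clean_iff_separated:
  assumes w: "w \<in> topspace W"
  shows "clean_point W \<Z> w \<longleftrightarrow> po_separated P (\<tau> w)"
proof
  assume "clean_point W \<Z> w"
  then obtain p A where "p \<in> pts P" "w \<in> block \<Z> p" "p_trim W \<Z> p A"
    by (auto simp: clean_point_def)
  then show "po_separated P (\<tau> w)"
    using p_trim_separated label_eqI[OF part] by simp
next
  assume "po_separated P (\<tau> w)"
  then obtain A where "p_trim W \<Z> (\<tau> w) A" "w \<in> A"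
    using separated_p_trim_neighbourhood[OF openin_topspace w] by metis
  then show "clean_point W \<Z> w"
    unfolding clean_point_def using label_mem[OF w] label_in_block[OF w] by blast
qed

text \<open>The label of \<open>w\<close> need not be separated.  When \<open>q = \<tau> x\<close> is different from \<open>\<tau> w\<close>, the point \<open>w\<close> is not
  in the closure of the block of \<open>q\<close>, so it has a neighbourhood that avoids this block and has only
  labels above \<open>q\<close>; this can be adjoined to a \<open>q\<close>-trim neighbourhood of \<open>x\<close>.\<close>

lemma ex_p_trim_containing:
  assumes w: "openin W U" "w \<in> U" and x: "x \<in> U"
    and sep: "po_separated P (\<tau> x)" and le: "po_le P (\<tau> x) (\<tau> w)"
  obtains A where "p_trim W \<Z> (\<tau> x) A" "w \<in> A" "A \<subseteq> U"
proof (cases "\<tau> x = \<tau> w")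
  case True
  then show thesis using separated_p_trim_neighbourhood[OF w] sep that by metis
next
  case False
  let ?q = "\<tau> x" and ?V = "{y \<in> topspace W. po_le P (\<tau> x) (\<tau> y)}"
  have wW: "w \<in> topspace W" using w openin_subset by blast
  obtain C where C: "p_trim W \<Z> ?q C" "x \<in> C" "C \<subseteq> U"
    using separated_p_trim_neighbourhood[OF w(1) x sep] .
  have q: "?q \<in> pts P" by (rule p_trim_mem[OF C(1)])
  have "\<not> po_le P (\<tau> w) ?q" using po_le_antisym[OF P_po le] False by blast
  then have ncl: "w \<notin> W closure_of block \<Z> ?q" using label_le_iff_closure[OF wW q] by simp
  have "openin W (U \<inter> ?V - W closure_of block \<Z> ?q)"
    using w(1) openin_labels_above_separated[OF sep] by (simp add: openin_Int openin_diff)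
  moreover have "w \<in> U \<inter> ?V - W closure_of block \<Z> ?q" using w(2) wW le ncl by simp
  ultimately obtain B where B: "B \<in> compact_opens W" "w \<in> B"
    "B \<subseteq> U \<inter> ?V - W closure_of block \<Z> ?q"
    by (rule ex_compact_open)
  have "p_trim W \<Z> ?q (C \<union> B)"
  proof (rule p_trim_extend[OF C(1) B(1)])
    show "po_le P ?q r" if r: "r \<in> pts P" "B \<inter> block \<Z> r \<noteq> {}" for r
    proof -
      obtain y where "y \<in> B" "y \<in> block \<Z> r" using r(2) by blast
      then show ?thesis using B(3) label_eqI[OF part _ r(1)] by blast
    qed
    show "B \<inter> block \<Z> ?q = {}"
      using B(3) closure_of_subset[OF block_topspace[OF part q]] by blast
  qed
  then show thesis using that B(2,3) C(3) by blast
qed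

lemma trim_labels_eq:
  assumes w: "w \<in> topspace W"
  shows "trim_labels W \<Z> w = {q. po_separated P q \<and> po_le P q (\<tau> w)}"
proof (intro set_eqI iffI)
  fix q assume "q \<in> trim_labels W \<Z> w"
  then obtain A where A: "p_trim W \<Z> q A" "w \<in> A" by (auto simp: trim_labels_def)
  then show "q \<in> {q. po_separated P q \<and> po_le P q (\<tau> w)}"
    using p_trim_separated p_trim_le[OF A label_in_block[OF w] label_mem[OF w]] by simp
next
  fix q assume "q \<in> {q. po_separated P q \<and> po_le P q (\<tau> w)}"
  then have q: "po_separated P q" "po_le P q (\<tau> w)" "q \<in> pts P" by (auto simp: po_separated_def)
  obtain x where x: "x \<in> block \<Z> q" using block_nonempty[OF part q(3)] by blast
  have xW: "x \<in> topspace W" using block_topspace[OF part q(3)] x by blast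
  have "\<tau> x = q" by (rule label_eqI[OF part x q(3)])
  then obtain A where "p_trim W \<Z> q A" "w \<in> A"
    using ex_p_trim_containing[OF openin_topspace w xW] q by metis
  then show "q \<in> trim_labels W \<Z> w" by (auto simp: trim_labels_def)
qed

abbreviation S where "S \<equiv> {q. po_separated P q}"
abbreviation interior where "interior \<equiv> clean_interior W \<Z>"

lemma S_subset: "q \<in> S \<Longrightarrow> q \<in> pts P"
  by (simp add: po_separated_def)

lemma index_interior: "pts (index interior) = S" "lt (index interior) = lt P \<inter> S \<times> S"
  by (simp_all add: clean_interior_def P_hat_separated)

lemma block_interior: "q \<in> S \<Longrightarrow> block interior q = block \<Z> q"
proof -
  assume q: "q \<in> S"
  have "clean_point W \<Z> w" if "w \<in> block \<Z> q" for w
    using that q clean_iff_separated block_topspace[OF part S_subset[OF q]]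
      label_eqI[OF part that S_subset[OF q]] by auto
  then show ?thesis by (auto simp: clean_interior_def)
qed

lemma po_le_interior: "p \<in> S \<Longrightarrow> q \<in> S \<Longrightarrow> po_le (index interior) p q \<longleftrightarrow> po_le P p q"
  using S_subset by (auto simp: po_le_def index_interior)

lemma pts_d_interior: "q \<in> S \<Longrightarrow> q \<in> pts_d (index interior) \<longleftrightarrow> q \<in> pts_d P"
  using S_subset by (auto simp: pts_d_def index_interior)

text \<open>Forgetting the non-separated labels does not create new trim sets, because each label that
  occurs in a compact open set lies above a separated one that also occurs in it.\<close>

lemma p_trim_interior_iff:
  "p_trim W interior q A \<longleftrightarrow> p_trim W \<Z> q A"
proof
  assume A: "p_trim W interior q A"
  have q: "q \<in> S" using p_trim_mem[OF A] by (simp add: index_interior)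
  have cA: "A \<in> compact_opens W" by (rule p_trim_compact_open[OF A])
  have "A \<inter> block \<Z> r \<noteq> {} \<longleftrightarrow> po_le P q r" if r: "r \<in> pts P" for r
  proof
    assume "A \<inter> block \<Z> r \<noteq> {}"
    then obtain w where w: "w \<in> A" "w \<in> block \<Z> r" by blast
    have "\<tau> w = r" by (rule label_eqI[OF part w(2) r])
    then obtain x where x: "x \<in> A" "\<tau> x \<in> S" "po_le P (\<tau> x) r"
      using ex_separated_label_below[OF cA w(1)] by blast
    have "x \<in> block interior (\<tau> x)"
      using block_interior[OF x(2)] label_in_block[OF p_trim_topspace[OF A x(1)]] by simp
    then have "po_le (index interior) q (\<tau> x)"
      using p_trim_le[OF A x(1)] x(2) by (simp add: index_interior)
    then show "po_le P q r"
      using po_le_trans[OF P_po _ x(3)] po_le_interior[OF q x(2)] by blast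
  next
    assume le: "po_le P q r"
    obtain x where x: "x \<in> A" "x \<in> block interior q" using p_trim_meets_own_block[OF A] .
    then have "x \<in> W closure_of block \<Z> r"
      using le_iff_closure[OF part _ S_subset[OF q] r] le block_interior[OF q] by blast
    then show "A \<inter> block \<Z> r \<noteq> {}"
      using x(1) compact_opens_openin[OF cA] unfolding in_closure_of by blast
  qed
  then have "{r \<in> pts P. A \<inter> block \<Z> r \<noteq> {}} = up_set P q"
    by (auto simp: up_set_def)
  then show "p_trim W \<Z> q A"
    using A S_subset[OF q] pts_d_interior[OF q] block_interior[OF q] unfolding p_trim_def by simp
next
  assume A: "p_trim W \<Z> q A"
  have q: "q \<in> S" using p_trim_separated[OF A] by simp
  have "A \<inter> block interior r \<noteq> {} \<longleftrightarrow> po_le (index interior) q r" if r: "r \<in> S" for r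
    using p_trim_iff_le[OF A S_subset[OF r]] block_interior[OF r] po_le_interior[OF q r] by simp
  then have "{r \<in> pts (index interior). A \<inter> block interior r \<noteq> {}} = up_set (index interior) q"
    unfolding up_set_def index_interior(1) by blast
  then show "p_trim W interior q A"
    using A q pts_d_interior[OF q] block_interior[OF q] unfolding p_trim_def index_interior(1) by simp
qed

lemma trim_labels_interior: "trim_labels W interior w = trim_labels W \<Z> w"
  by (simp add: trim_labels_def p_trim_interior_iff)

lemma partition_interior: "P_partition W interior"
  unfolding P_partition_def
proof (intro conjI ballI)
  show "is_po_system (index interior)"
    using is_po_system_restrict[OF P_po] by (simp add: clean_interior_def)
  show "disjoint_family_on (block interior) (pts (index interior))"
    using block_unique[OF part] block_interior S_subset
    by (auto simp: disjoint_family_on_def index_interior)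
  fix p assume "p \<in> pts (index interior)"
  then have p: "p \<in> S" by (simp add: index_interior)
  show "block interior p \<noteq> {}" "block interior p \<subseteq> topspace W"
    using block_nonempty[OF part] block_topspace[OF part] S_subset[OF p] block_interior[OF p]
    by auto
  have sup: "support interior = (\<Union>q\<in>S. block \<Z> q)"
    using block_interior by (simp add: support_def index_interior)
  have "w \<in> W derived_set_of block \<Z> p \<longleftrightarrow> (q, p) \<in> lt P" if "q \<in> S" "w \<in> block \<Z> q" for w q
    using lt_iff_limit_point[OF part that(2)] S_subset[OF that(1)] S_subset[OF p] by blast
  then have "(W derived_set_of block \<Z> p) \<inter> (\<Union>q\<in>S. block \<Z> q) =
      (\<Union>q\<in>{q \<in> S. (q, p) \<in> lt P}. block \<Z> q)"
    by blast
  also have "\<dots> = (\<Union>q\<in>{q \<in> pts (index interior). (q, p) \<in> lt (index interior)}. block interior q)"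
    using p block_interior by (auto simp: index_interior)
  finally show "(W derived_set_of block interior p) \<inter> support interior =
      (\<Union>q\<in>{q \<in> pts (index interior). (q, p) \<in> lt (index interior)}. block interior q)"
    using sup block_interior[OF p] by simp
qed

text \<open>A point with non-separated label has, in any given neighbourhood, a point whose separated label is
  below its own, and a trim set around both points; this gives the first axiom.  For the second, if
  \<open>w\<close> has a neighbourhood base of \<open>q\<close>-trim sets, then it lies in the closure of the block of \<open>q\<close>, so
  \<open>\<tau> w \<le> q\<close>, while \<open>w\<close> being in a \<open>q\<close>-trim set gives \<open>q \<le> \<tau> w\<close>.\<close>

theorem trim_interior: "trim_partition W interior"
  unfolding trim_partition_def
proof (intro conjI ballI allI impI partition_interior)
  fix w U assume wU: "openin W U \<and> w \<in> U"
  then obtain K where K: "K \<in> compact_opens W" "w \<in> K" "K \<subseteq> U" using ex_compact_open by metis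
  obtain x where x: "x \<in> K" "po_separated P (\<tau> x)" "po_le P (\<tau> x) (\<tau> w)"
    using ex_separated_label_below[OF K(1,2)] .
  obtain A where "p_trim W \<Z> (\<tau> x) A" "w \<in> A" "A \<subseteq> K"
    using ex_p_trim_containing[OF compact_opens_openin[OF K(1)] K(2) x] .
  then show "\<exists>A. trim_set W interior A \<and> w \<in> A \<and> A \<subseteq> U"
    using K(3) p_trim_interior_iff unfolding trim_set_def by blast
next
  fix q w assume "q \<in> P_hat W interior" and w: "w \<in> topspace W"
    and base: "\<forall>U. openin W U \<and> w \<in> U \<longrightarrow> (\<exists>A. p_trim W interior q A \<and> w \<in> A \<and> A \<subseteq> U)"
  then have q: "q \<in> S" by (simp add: P_hat_def index_interior)
  have "w \<in> W closure_of block \<Z> q"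
    unfolding in_closure_of
  proof (intro conjI allI impI w)
    fix U assume "w \<in> U \<and> openin W U"
    then obtain A where A: "p_trim W \<Z> q A" "A \<subseteq> U" using base p_trim_interior_iff by metis
    then show "\<exists>y. y \<in> block \<Z> q \<and> y \<in> U" using p_trim_meets_own_block[OF A(1)] by blast
  qed
  then have "po_le P (\<tau> w) q" using label_le_iff_closure[OF w S_subset[OF q]] by simp
  moreover obtain A where A: "p_trim W \<Z> q A" "w \<in> A"
    using base w p_trim_interior_iff by (metis openin_topspace)
  then have "po_le P q (\<tau> w)" using p_trim_le label_in_block[OF w] label_mem[OF w] by metis
  ultimately have "\<tau> w = q" by (rule po_le_antisym[OF P_po])
  then show "w \<in> block interior q" using label_in_block[OF w] block_interior[OF q] by simp
next
  fix w assume "w \<in> support interior"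
  then obtain q where q: "q \<in> S" "w \<in> block \<Z> q"
    using block_interior by (auto simp: support_def index_interior)
  have wW: "w \<in> topspace W" using block_topspace[OF part S_subset[OF q(1)]] q(2) by blast
  have tq: "\<tau> w = q" by (rule label_eqI[OF part q(2) S_subset[OF q(1)]])
  then have "po_separated P (\<tau> w)" using q(1) by simp
  then obtain A where "p_trim W \<Z> q A" "w \<in> A"
    using separated_p_trim_neighbourhood[OF openin_topspace wW] unfolding tq by metis
  then show "clean_point W interior w"
    unfolding clean_point_def using q block_interior[OF q(1)] p_trim_interior_iff
    by (auto simp: index_interior)
qed

text \<open>The labels of the trim sets around \<open>w\<close> are the separated labels below \<open>\<tau> w\<close>.  So sending \<open>p\<close> to the set
  of separated labels below \<open>p\<close> translates \<open>\<tau> w\<close> into \<open>I\<^sub>w\<close>; it reaches every ideal, as every ideal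
  occurs as some \<open>I\<^sub>w\<close>, and it is injective because separated labels determine \<open>p\<close>.\<close>

theorem relabels_completion_interior:
  "relabels_via (\<lambda>p. {q \<in> S. po_le P q p}) \<Z> (ideal_completion W interior)"
proof -
  interpret Y: trim_partitioned W interior
    by unfold_locales (rule trim_interior)
  define f where "f p = {q \<in> S. po_le P q p}" for p
  have I: "Y.I w = f (\<tau> w)" if "w \<in> topspace W" for w
    using trim_labels_eq[OF that] by (simp add: trim_labels_interior f_def)
  have ex: "\<exists>w\<in>topspace W. \<tau> w = p" if p: "p \<in> pts P" for p
    using block_nonempty[OF part p] block_topspace[OF part p] label_eqI[OF part _ p] by blast
  have ideal: "po_ideal Y.P (f p)" if p: "p \<in> pts P" for p
  proof -
    obtain w where "w \<in> topspace W" "\<tau> w = p" using ex[OF p] by blast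
    then show ?thesis using Y.po_ideal_I I by metis
  qed
  have f_le: "f p \<subseteq> f q \<longleftrightarrow> po_le P p q" if pq: "p \<in> pts P" "q \<in> pts P" for p q
  proof
    assume sub: "f p \<subseteq> f q"
    obtain w where w: "w \<in> topspace W" "\<tau> w = p" using ex[OF pq(1)] by blast
    have "po_le P r q" if "po_separated P r" "po_le P r (\<tau> w)" for r
      using sub that w(2) by (auto simp: f_def)
    then show "po_le P p q" using label_le_if_separated_le[OF w(1) pq(2)] w(2) by simp
  next
    assume "po_le P p q"
    then show "f p \<subseteq> f q" using po_le_trans[OF P_po] by (auto simp: f_def)
  qed
  have f_eq: "f p = f q \<longleftrightarrow> p = q" if "p \<in> pts P" "q \<in> pts P" for p q
    using f_le that po_le_antisym[OF P_po] by (metis subset_refl)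
  have f_S: "f q = down_set Y.P q" if q: "q \<in> S" for q
  proof (intro set_eqI)
    fix r
    show "r \<in> f q \<longleftrightarrow> r \<in> down_set Y.P q"
      using po_le_interior[OF _ q, of r] po_le_mem(1)[of Y.P r q]
      by (auto simp: f_def down_set_iff index_interior)
  qed
  have blk: "block (ideal_completion W interior) (f p) = block \<Z> p" if p: "p \<in> pts P" for p
  proof (intro set_eqI iffI)
    fix w assume "w \<in> block (ideal_completion W interior) (f p)"
    then have w: "w \<in> topspace W" "Y.I w = f p" by (simp_all add: Y.block_completion)
    then have "\<tau> w = p" using I[OF w(1)] f_eq[OF label_mem[OF w(1)] p] by simp
    then show "w \<in> block \<Z> p" using label_in_block[OF w(1)] by simp
  next
    fix w assume w: "w \<in> block \<Z> p"
    then have "w \<in> topspace W" using block_topspace[OF part p] by blast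
    then show "w \<in> block (ideal_completion W interior) (f p)"
      using I label_eqI[OF part w p] by (simp add: Y.block_completion)
  qed
  have surj: "f ` pts P = {J. po_ideal Y.P J}"
  proof
    show "f ` pts P \<subseteq> {J. po_ideal Y.P J}" using ideal by blast
    show "{J. po_ideal Y.P J} \<subseteq> f ` pts P"
    proof
      fix J assume "J \<in> {J. po_ideal Y.P J}"
      then have "block Y.completion J \<noteq> {}"
        using block_nonempty[OF Y.partition_completion] by (simp add: Y.index_completion pts_id_po)
      then obtain w where "w \<in> block Y.completion J" by blast
      then have "w \<in> topspace W" "Y.I w = J" by (simp_all add: Y.block_completion)
      then show "J \<in> f ` pts P" using I label_mem by blast
    qed
  qed
  \<comment> \<open>The order is determined by the limit points of the blocks, and these have not changed.\<close>
  have lt: "(p, q) \<in> lt P \<longleftrightarrow> (f p, f q) \<in> lt (id_po Y.P)" if pq: "p \<in> pts P" "q \<in> pts P" for p q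
  proof -
    obtain w where w: "w \<in> block \<Z> p" using block_nonempty[OF part pq(1)] by blast
    have "(p, q) \<in> lt P \<longleftrightarrow> w \<in> W derived_set_of block \<Z> q"
      by (rule lt_iff_limit_point[OF part w pq])
    also have "\<dots> \<longleftrightarrow> (f p, f q) \<in> lt (id_po Y.P)"
      using lt_iff_limit_point[OF Y.partition_completion, of w "f p" "f q"] w blk pq ideal
      by (simp add: Y.index_completion pts_id_po)
    finally show ?thesis .
  qed
  have "relabels_via f \<Z> Y.completion"
    using P_po is_po_system_id_po f_eq surj lt blk
    by (auto simp: relabels_via_def Y.index_completion bij_betw_def inj_on_def pts_id_po)
  then show ?thesis unfolding f_def .
qed

end


section \<open>The correspondence\<close>

lemma ideal_completion_of_trim_partition:
  assumes "omega_stone_space W" "trim_partition W \<Y>"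
  shows "rank_partition W (ideal_completion W \<Y>)"
    and "clean_interior W (ideal_completion W \<Y>) \<simeq>\<^sub>r \<Y>"
proof -
  interpret trim_partitioned W \<Y>
    using assms by unfold_locales
  show "rank_partition W (ideal_completion W \<Y>)" by (rule rank_completion)
  show "clean_interior W (ideal_completion W \<Y>) \<simeq>\<^sub>r \<Y>"
    using relabels_clean_interior_completion relabels_via_sym
    unfolding same_up_to_relabelling_def by blast
qed

lemma clean_interior_of_rank_partition:
  assumes "omega_stone_space W" "rank_partition W \<Z>"
  shows "trim_partition W (clean_interior W \<Z>)"
    and "ideal_completion W (clean_interior W \<Z>) \<simeq>\<^sub>r \<Z>"
proof -
  interpret rank_partitioned W \<Z>
    using assms by unfold_locales
  show "trim_partition W (clean_interior W \<Z>)" by (rule trim_interior)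
  show "ideal_completion W (clean_interior W \<Z>) \<simeq>\<^sub>r \<Z>"
    using relabels_completion_interior relabels_via_sym
    unfolding same_up_to_relabelling_def by blast
qed

theorem corollary4p22:
  fixes W :: "'w topology"
  assumes "omega_stone_space W" and "primitive_space W"
  shows "bij_betw (id_map W) (trim_partitions W) (rank_partitions W) \<and>
     bij_betw (clean_interior_map W) (rank_partitions W) (trim_partitions W) \<and>
     (\<forall>\<Y>\<in>trim_partitions W. clean_interior_map W (id_map W \<Y>) = \<Y>) \<and>
     (\<forall>\<Z>\<in>rank_partitions W. id_map W (clean_interior_map W \<Z>) = \<Z>) \<and>
     (\<forall>\<Y> :: ('p, 'w) labelled_family. trim_partition W \<Y> \<longrightarrow>
        rank_partition W (ideal_completion W \<Y>) \<and>
        clean_interior W (ideal_completion W \<Y>) \<simeq>\<^sub>r \<Y>) \<and>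
     (\<forall>\<Z> :: ('q, 'w) labelled_family. rank_partition W \<Z> \<longrightarrow>
        trim_partition W (clean_interior W \<Z>) \<and>
        ideal_completion W (clean_interior W \<Z>) \<simeq>\<^sub>r \<Z>) \<and>
     (\<forall>\<Z> :: ('q, 'w) labelled_family. rank_partition W \<Z> \<longleftrightarrow>
        (\<exists>\<Y> :: ('q, 'w) labelled_family. trim_partition W \<Y> \<and> \<Z> \<simeq>\<^sub>r ideal_completion W \<Y>))"
proof (intro conjI allI ballI impI)
  note W = assms(1)
  have id_mem: "id_map W \<Y> \<in> rank_partitions W" if "\<Y> \<in> trim_partitions W" for \<Y>
    unfolding id_map_def using that
    by (intro canonical_mem_rank_partitions ideal_completion_of_trim_partition(1)[OF W])
      (simp add: trim_partitions_def)
  have int_mem: "clean_interior_map W \<Z> \<in> trim_partitions W" if "\<Z> \<in> rank_partitions W" for \<Z>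
    unfolding clean_interior_map_def using that
    by (intro canonical_mem_trim_partitions clean_interior_of_rank_partition(1)[OF W])
      (simp add: rank_partitions_def)
  show int_id: "clean_interior_map W (id_map W \<Y>) = \<Y>" if Y: "\<Y> \<in> trim_partitions W" for \<Y>
  proof -
    have t: "trim_partition W \<Y>" and c: "canonical \<Y> = \<Y>"
      using Y by (simp_all add: trim_partitions_def)
    have "P_partition W (ideal_completion W \<Y>)"
      using ideal_completion_of_trim_partition(1)[OF W t] by (simp add: rank_partition_def)
    from clean_interior_map_canonical[OF this] show ?thesis
      using canonical_cong[OF ideal_completion_of_trim_partition(2)[OF W t]] c
      by (simp add: id_map_def)
  qed
  show id_int: "id_map W (clean_interior_map W \<Z>) = \<Z>" if Z: "\<Z> \<in> rank_partitions W" for \<Z>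
  proof -
    have t: "rank_partition W \<Z>" and c: "canonical \<Z> = \<Z>"
      using Z by (simp_all add: rank_partitions_def)
    have "P_partition W (clean_interior W \<Z>)"
      using clean_interior_of_rank_partition(1)[OF W t] by (simp add: trim_partition_def)
    from id_map_canonical[OF this] show ?thesis
      using canonical_cong[OF clean_interior_of_rank_partition(2)[OF W t]] c
      by (simp add: clean_interior_map_def)
  qed
  show "bij_betw (id_map W) (trim_partitions W) (rank_partitions W)"
    by (rule bij_betw_byWitness[where f' = "clean_interior_map W"])
      (use int_id id_int id_mem int_mem in auto)
  show "bij_betw (clean_interior_map W) (rank_partitions W) (trim_partitions W)"
    by (rule bij_betw_byWitness[where f' = "id_map W"])
      (use int_id id_int id_mem int_mem in auto)
next
  fix \<Y> :: "('p, 'w) labelled_family"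
  assume "trim_partition W \<Y>"
  then show "rank_partition W (ideal_completion W \<Y>)" "clean_interior W (ideal_completion W \<Y>) \<simeq>\<^sub>r \<Y>"
    using ideal_completion_of_trim_partition[OF assms(1)] by blast+
next
  fix \<Z> :: "('q, 'w) labelled_family"
  assume "rank_partition W \<Z>"
  then show "trim_partition W (clean_interior W \<Z>)" "ideal_completion W (clean_interior W \<Z>) \<simeq>\<^sub>r \<Z>"
    using clean_interior_of_rank_partition[OF assms(1)] by blast+
next
  fix \<Z> :: "('q, 'w) labelled_family"
  show "rank_partition W \<Z> \<longleftrightarrow>
      (\<exists>\<Y> :: ('q, 'w) labelled_family. trim_partition W \<Y> \<and> \<Z> \<simeq>\<^sub>r ideal_completion W \<Y>)"
  proof
    assume "rank_partition W \<Z>"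
    then show "\<exists>\<Y> :: ('q, 'w) labelled_family. trim_partition W \<Y> \<and> \<Z> \<simeq>\<^sub>r ideal_completion W \<Y>"
      using clean_interior_of_rank_partition[OF assms(1)] same_up_to_relabelling_sym by blast
  next
    assume "\<exists>\<Y> :: ('q, 'w) labelled_family. trim_partition W \<Y> \<and> \<Z> \<simeq>\<^sub>r ideal_completion W \<Y>"
    then obtain \<Y> :: "('q, 'w) labelled_family" and f where "trim_partition W \<Y>"
      and f: "relabels_via f (ideal_completion W \<Y>) \<Z>"
      using same_up_to_relabelling_sym unfolding same_up_to_relabelling_def by blast
    then show "rank_partition W \<Z>"
      by (intro relabel_rank_partition[OF f] ideal_completion_of_trim_partition(1)[OF assms(1)])
  qed
qed

end
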